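(* Let $\Gamma$ be a countable weakly amenable group with Cowling--Haagerup constant $\boldsymbol\Lambda(\Gamma)=1$. Then $\Gamma$ admits a proper uniformly Lipschitz affine action on a subspace of an $L^1$ space; that is, there exist a measure space $(\Omega,\mu)$, a closed subspace $E\subseteq L^1(\Omega,\mu)$, and a proper uniformly Lipschitz affine action of $\Gamma$ on $E$.
   Context: Groups are discrete. Herz--Schur multipliers. $B_2(\Gamma)$ is the space of functions $\varphi:\Gamma\to\mathbb{C}$ for which there exist a Hilbert space $\mathcal{H}$ and bounded maps $\xi,\eta:\Gamma\to\mathcal{H}$ with $\varphi(y^{-1}x)=\langle\xi(x),\eta(y)\rangle$ for all $x,y\in\Gamma$; the norm $\lVert\varphi\rVert_{B_2(\Gamma)}$ is the infimum of $\sup_x\lVert\xi(x)\rVert\cdot\sup_y\lVert\eta(y)\rVert$ over all such representations. Weak amenability. A countable group $\Gamma$ is weakly amenable if there exist a sequence of finitely supported functions $\varphi_n:\Gamma\to\mathbb{C}$ converging pointwise to $1$ and a constant $C\geq1$ such that $\sup_n\lVert\varphi_n\rVert_{B_2(\Gamma)}\leq C$. The Cowling--Haagerup constant $\boldsymbol\Lambda(\Gamma)$ is the infimum of all $C\geq1$ such that this condition holds. Affine actions. $L^1(\Omega,\mu)$ is the real Banach space of integrable real-valued functions. An affine action $\sigma$ of $\Gamma$ on a real Banach space $E$ is given by a group homomorphism $\pi:\Gamma\to\operatorname{GL}(E)$ (invertible bounded linear operators) and a map $b:\Gamma\to E$ satisfying $b(st)=\pi(s)b(t)+b(s)$ for all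 $s,t\in\Gamma$, through $\sigma(s)v=\pi(s)v+b(s)$. It is uniformly Lipschitz if there is $C\ge1$ such that $\lVert\sigma(s)v-\sigma(s)w\rVert\leq C\lVert v-w\rVert$ for all $s\in\Gamma$, $v,w\in E$. It is proper if for every $v\in E$ and $R>0$ the set $\{s\in\Gamma : \lVert\sigma(s)v-v\rVert\le R\}$ is finite. *)

theory Defs
  imports "HOL-Analysis.Analysis" "HOL-Algebra.Module" "HOL-Algebra.Bij"
begin

section \<open>Scalars\<close>

definition scalars :: "'k::field ring" where
  "scalars = \<lparr>carrier = UNIV, mult = (*), one = 1, zero = 0, add = (+)\<rparr>"

lemma scalars_simps [simp]:
  "carrier scalars = UNIV" "x \<otimes>\<^bsub>scalars\<^esub> y = x * y" "\<one>\<^bsub>scalars\<^esub> = 1"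
  "\<zero>\<^bsub>scalars\<^esub> = 0" "x \<oplus>\<^bsub>scalars\<^esub> y = x + y"
  by (simp_all add: scalars_def)

lemma cring_scalars: "cring (scalars :: 'k::field ring)"
proof (rule cringI)
  show "abelian_group (scalars :: 'k ring)"
  proof (rule abelian_groupI)
    fix x :: 'k assume "x \<in> carrier scalars"
    show "\<exists>y\<in>carrier scalars. y \<oplus>\<^bsub>scalars\<^esub> x = \<zero>\<^bsub>scalars\<^esub>"
      by (rule bexI[of _ "- x"]) simp_all
  qed (simp_all add: algebra_simps)
  show "comm_monoid (scalars :: 'k ring)"
    by (rule comm_monoidI) (simp_all add: algebra_simps)
qed (simp add: algebra_simps)


section \<open>Complex Hilbert spaces\<close>

text \<open>The inner product is linear in its first argument. The multiplication and unit fields that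
  every module record inherits from the ring record play no role.\<close>

record 'h hilbert = "(complex, 'h) module" +
  ip :: "'h \<Rightarrow> 'h \<Rightarrow> complex"

definition hnorm :: "('h, 'm) hilbert_scheme \<Rightarrow> 'h \<Rightarrow> real" where
  "hnorm H x = sqrt (Re (ip H x x))"

locale complex_hilbert_space = module scalars H for H :: "('h, 'm) hilbert_scheme" (structure) +
  assumes ip_add: "\<lbrakk>x \<in> carrier H; y \<in> carrier H; z \<in> carrier H\<rbrakk>
      \<Longrightarrow> ip H (x \<oplus> y) z = ip H x z + ip H y z"
    and ip_smult: "\<lbrakk>x \<in> carrier H; y \<in> carrier H\<rbrakk> \<Longrightarrow> ip H (c \<odot> x) y = c * ip H x y"
    and ip_cnj: "\<lbrakk>x \<in> carrier H; y \<in> carrier H\<rbrakk> \<Longrightarrow> ip H y x = cnj (ip H x y)"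
    and ip_nonneg: "x \<in> carrier H \<Longrightarrow> 0 \<le> Re (ip H x x)"
    and ip_definite: "\<lbrakk>x \<in> carrier H; ip H x x = 0\<rbrakk> \<Longrightarrow> x = \<zero>"
    and complete: "\<lbrakk>\<And>n. X n \<in> carrier H;
        \<And>e. e > 0 \<Longrightarrow> \<exists>N. \<forall>m\<ge>N. \<forall>n\<ge>N. hnorm H (X m \<ominus> X n) < e\<rbrakk>
      \<Longrightarrow> \<exists>l\<in>carrier H. (\<lambda>n::nat. hnorm H (X n \<ominus> l)) \<longlonglongrightarrow> 0"

context complex_hilbert_space
begin

lemma minus_smult: "y \<in> carrier H \<Longrightarrow> \<ominus> y = (- 1) \<odot> y"
proof -
  assume y: "y \<in> carrier H"
  have "((-1) \<odot> y) \<oplus> y = ((-1) \<oplus>\<^bsub>scalars\<^esub> 1) \<odot> y"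
    using y smult_l_distr[of "-1" 1 y] smult_one[of y] by simp
  also have "\<dots> = \<zero>" using smult_l_null[OF y] by simp
  finally show ?thesis using y by (intro minus_equality) auto
qed

lemma ip_minus:
  "\<lbrakk>x \<in> carrier H; y \<in> carrier H; z \<in> carrier H\<rbrakk> \<Longrightarrow> ip H (x \<ominus> y) z = ip H x z - ip H y z"
  by (simp add: a_minus_def ip_add minus_smult ip_smult)

lemma ip_add_right: "\<lbrakk>x \<in> carrier H; y \<in> carrier H; z \<in> carrier H\<rbrakk>
    \<Longrightarrow> ip H z (x \<oplus> y) = ip H z x + ip H z y"
  using ip_cnj[of "x \<oplus> y" z] ip_cnj[of x z] ip_cnj[of y z] by (simp add: ip_add)

lemma ip_smult_right: "\<lbrakk>x \<in> carrier H; y \<in> carrier H\<rbrakk> \<Longrightarrow> ip H y (c \<odot> x) = cnj c * ip H y x"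
  using ip_cnj[of "c \<odot> x" y] ip_cnj[of x y] by (simp add: ip_smult)

lemma ip_minus_right:
  "\<lbrakk>x \<in> carrier H; y \<in> carrier H; z \<in> carrier H\<rbrakk> \<Longrightarrow> ip H z (x \<ominus> y) = ip H z x - ip H z y"
  by (simp add: a_minus_def ip_add_right minus_smult ip_smult_right)

lemma ip_self: "x \<in> carrier H \<Longrightarrow> ip H x x = complex_of_real ((hnorm H x)\<^sup>2)"
  using ip_cnj[of x x] ip_nonneg[of x] by (auto simp: hnorm_def complex_eq_iff)

lemma ip_zero: "x \<in> carrier H \<Longrightarrow> ip H \<zero> x = 0"
  using ip_smult[of x x 0] smult_l_null[of x] by simp

lemma cauchy_schwarz:
  assumes x: "x \<in> carrier H" and y: "y \<in> carrier H"
  shows "cmod (ip H x y) \<le> hnorm H x * hnorm H y"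
proof (cases "hnorm H y = 0")
  case True
  then have "y = \<zero>" using ip_definite[OF y] ip_self[OF y] by simp
  then show ?thesis using ip_zero[OF x] ip_cnj[OF _ x, of y] y True by simp
next
  case False
  define n where "n = hnorm H y"
  define c where "c = ip H x y / complex_of_real (n\<^sup>2)"
  define z where "z = x \<ominus> c \<odot> y"
  have n: "n > 0" using False ip_nonneg[OF y] by (simp add: n_def hnorm_def)
  have z: "z \<in> carrier H" "c \<odot> y \<in> carrier H" using x y by (auto simp: z_def)
  have yx: "ip H y x = cnj (ip H x y)" using ip_cnj x y by blast
  have yy: "ip H y y = complex_of_real (n\<^sup>2)" using ip_self[OF y] by (simp add: n_def)
  have zy: "ip H z y = 0"
    using n x y z yy by (simp add: z_def ip_minus ip_smult c_def)
  have "ip H z z = ip H z x"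
    using x y z zy by (subst (2) z_def) (simp add: ip_minus_right ip_smult_right)
  also have "\<dots> = ip H x x - c * cnj (ip H x y)"
    using x y z by (simp add: z_def ip_minus ip_smult yx)
  also have "c * cnj (ip H x y) = complex_of_real ((cmod (ip H x y))\<^sup>2 / n\<^sup>2)"
    by (simp add: c_def complex_norm_square[symmetric])
  finally have "0 \<le> (hnorm H x)\<^sup>2 - (cmod (ip H x y))\<^sup>2 / n\<^sup>2"
    using ip_nonneg[OF z(1)] ip_self[OF x] by simp
  then have "(cmod (ip H x y))\<^sup>2 \<le> (hnorm H x * n)\<^sup>2"
    using n by (simp add: field_simps power_mult_distrib)
  then show ?thesis
    using n ip_nonneg[OF x] by (auto simp: n_def hnorm_def intro: power2_le_imp_le)
qed

definition closed_submodule :: "'h set \<Rightarrow> bool" where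
  "closed_submodule W \<longleftrightarrow> submodule W scalars H \<and>
    (\<forall>X l. (\<forall>n::nat. X n \<in> W) \<and> l \<in> carrier H \<and> (\<lambda>n. hnorm H (X n \<ominus> l)) \<longlonglongrightarrow> 0 \<longrightarrow> l \<in> W)"

lemma closed_submodule_annihilator:
  assumes u: "u \<in> carrier H"
  shows "closed_submodule {v \<in> carrier H. ip H v u = 0}"
  unfolding closed_submodule_def
proof (intro conjI allI impI)
  show "submodule {v \<in> carrier H. ip H v u = 0} scalars H"
    using u by (intro submoduleI) (auto simp: ip_add ip_smult ip_zero minus_smult)
next
  fix X l assume A: "(\<forall>n::nat. X n \<in> {v \<in> carrier H. ip H v u = 0}) \<and> l \<in> carrier H \<and>
    (\<lambda>n. hnorm H (X n \<ominus> l)) \<longlonglongrightarrow> 0"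
  have "cmod (ip H l u) \<le> hnorm H (X n \<ominus> l) * hnorm H u" for n
    using A u cauchy_schwarz[of "X n \<ominus> l" u] by (simp add: ip_minus)
  moreover have "(\<lambda>n. hnorm H (X n \<ominus> l) * hnorm H u) \<longlonglongrightarrow> 0 * hnorm H u"
    using A by (intro tendsto_mult tendsto_const) simp
  ultimately have "cmod (ip H l u) \<le> 0 * hnorm H u"
    by (intro LIMSEQ_le_const) auto
  then show "l \<in> {v \<in> carrier H. ip H v u = 0}" using A by simp
qed

lemma closed_submodule_carrier: "closed_submodule (carrier H)"
  by (simp add: closed_submodule_def carrier_is_submodule)

lemma closed_submodule_Inter:
  assumes "F \<noteq> {}" "\<And>W. W \<in> F \<Longrightarrow> closed_submodule W"
  shows "closed_submodule (\<Inter>F)"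
  unfolding closed_submodule_def
proof (intro conjI allI impI)
  have s: "submodule W scalars H" if "W \<in> F" for W using assms that by (simp add: closed_submodule_def)
  show "submodule (\<Inter>F) scalars H"
  proof (rule submoduleI)
    show "\<Inter>F \<subseteq> carrier H" using assms(1) submoduleE(1)[OF s] by blast
    show "\<zero> \<in> \<Inter>F"
      using submodule.axioms(1)[OF s] subgroup.one_closed by fastforce
    show "\<ominus> a \<in> \<Inter>F" if "a \<in> \<Inter>F" for a
      using submoduleE(3)[OF s] that by blast
    show "a \<oplus> b \<in> \<Inter>F" if "a \<in> \<Inter>F" "b \<in> \<Inter>F" for a b
      using submoduleE(5)[OF s] that by blast
    show "a \<odot> x \<in> \<Inter>F" if "a \<in> carrier scalars" "x \<in> \<Inter>F" for a x
      using submoduleE(4)[OF s] that by blast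
  qed
next
  fix X l assume "(\<forall>n::nat. X n \<in> \<Inter>F) \<and> l \<in> carrier H \<and> (\<lambda>n. hnorm H (X n \<ominus> l)) \<longlonglongrightarrow> 0"
  then show "l \<in> \<Inter>F" using assms(2) unfolding closed_submodule_def by blast
qed

end

lemma (in complex_hilbert_space) transport:
  fixes J :: "'h \<Rightarrow> 'k"
  assumes W: "closed_submodule W" and J: "inj_on J W"
  obtains H' :: "'k hilbert" where
    "complex_hilbert_space H'" "carrier H' = J ` W"
    "\<And>v w. v \<in> W \<Longrightarrow> w \<in> W \<Longrightarrow> ip H' (J v) (J w) = ip H v w"
proof -
  define K where "K = inv_into W J"
  define H' :: "'k hilbert" where "H' = \<lparr>carrier = J ` W, mult = undefined, one = undefined,
    zero = J \<zero>, add = (\<lambda>a b. J (K a \<oplus> K b)), smult = (\<lambda>c a. J (c \<odot> K a)),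
    ip = (\<lambda>a b. ip H (K a) (K b))\<rparr>"
  have sub: "submodule W scalars H" using W by (simp add: closed_submodule_def)
  have K [simp]: "v \<in> W \<Longrightarrow> K (J v) = v" for v using J by (simp add: K_def)
  have Wc: "v \<in> W \<Longrightarrow> v \<in> carrier H" for v using submoduleE(1)[OF sub] by blast
  have W0: "\<zero> \<in> W" using subgroup.one_closed[OF submodule.axioms(1)[OF sub]] by simp
  note Wsm = submoduleE(4)[OF sub, simplified]
  note Wad = submoduleE(5)[OF sub] and Wmi = submoduleE(3)[OF sub]
  have carr: "carrier H' = J ` W" by (simp add: H'_def)
  have z: "\<zero>\<^bsub>H'\<^esub> = J \<zero>" by (simp add: H'_def)
  have ad: "J v \<oplus>\<^bsub>H'\<^esub> J w = J (v \<oplus> w)" if "v \<in> W" "w \<in> W" for v w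
    using that by (simp add: H'_def)
  have sm: "c \<odot>\<^bsub>H'\<^esub> J v = J (c \<odot> v)" if "v \<in> W" for c v
    using that by (simp add: H'_def)
  have ip': "ip H' (J v) (J w) = ip H v w" if "v \<in> W" "w \<in> W" for v w
    using that by (simp add: H'_def)
  have ab: "abelian_group H'"
  proof (rule abelian_groupI)
    fix a assume "a \<in> carrier H'"
    then obtain v where v: "v \<in> W" "a = J v" by (auto simp: carr)
    have "J (\<ominus> v) \<oplus>\<^bsub>H'\<^esub> a = \<zero>\<^bsub>H'\<^esub>"
      using v Wmi Wc by (simp add: ad z M.l_neg)
    then show "\<exists>b\<in>carrier H'. b \<oplus>\<^bsub>H'\<^esub> a = \<zero>\<^bsub>H'\<^esub>" using v Wmi by (auto simp: carr)
  qed (auto simp: carr z ad W0 Wad Wc M.a_ac intro!: imageI)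
  have mo: "module scalars H'"
  proof (rule moduleI[OF cring_scalars ab])
    show "(a \<oplus>\<^bsub>scalars\<^esub> b) \<odot>\<^bsub>H'\<^esub> x = a \<odot>\<^bsub>H'\<^esub> x \<oplus>\<^bsub>H'\<^esub> b \<odot>\<^bsub>H'\<^esub> x"
      if "x \<in> carrier H'" for a b x
      using that smult_l_distr[of a b] by (auto simp: carr ad sm Wsm Wc)
    show "(a \<otimes>\<^bsub>scalars\<^esub> b) \<odot>\<^bsub>H'\<^esub> x = a \<odot>\<^bsub>H'\<^esub> (b \<odot>\<^bsub>H'\<^esub> x)"
      if "x \<in> carrier H'" for a b x
      using that smult_assoc1[of a b] by (auto simp: carr sm Wsm Wc)
    show "\<one>\<^bsub>scalars\<^esub> \<odot>\<^bsub>H'\<^esub> x = x" if "x \<in> carrier H'" for x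
      using that smult_one by (auto simp: carr sm Wc)
    show "a \<odot>\<^bsub>H'\<^esub> (x \<oplus>\<^bsub>H'\<^esub> y) = a \<odot>\<^bsub>H'\<^esub> x \<oplus>\<^bsub>H'\<^esub> a \<odot>\<^bsub>H'\<^esub> y"
      if "x \<in> carrier H'" "y \<in> carrier H'" for a x y
      using that smult_r_distr[of a] by (auto simp: carr ad sm Wad Wsm Wc)
    show "a \<odot>\<^bsub>H'\<^esub> x \<in> carrier H'" if "x \<in> carrier H'" for a x
      using that by (auto simp: carr sm Wsm)
  qed
  interpret H': module scalars H' by (rule mo)
  have mi: "J v \<ominus>\<^bsub>H'\<^esub> J w = J (v \<ominus> w)" if "v \<in> W" "w \<in> W" for v w
  proof -
    have "\<ominus>\<^bsub>H'\<^esub> J w = J (\<ominus> w)"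
      using that Wmi Wc by (intro H'.minus_equality) (auto simp: ad z carr M.l_neg)
    then show ?thesis using that Wmi by (simp add: a_minus_def ad)
  qed
  have Wd: "v \<ominus> w \<in> W" if "v \<in> W" "w \<in> W" for v w
    using that Wmi Wad by (simp add: a_minus_def)
  have hn: "hnorm H' (J v) = hnorm H v" if "v \<in> W" for v
    using that by (simp add: hnorm_def ip')
  have "complex_hilbert_space H'"
  proof (intro complex_hilbert_space.intro mo complex_hilbert_space_axioms.intro)
    fix X :: "nat \<Rightarrow> 'k"
    assume X: "\<And>n. X n \<in> carrier H'"
      and C: "\<And>e. e > 0 \<Longrightarrow> \<exists>N. \<forall>m\<ge>N. \<forall>n\<ge>N. hnorm H' (X m \<ominus>\<^bsub>H'\<^esub> X n) < e"
    have "\<forall>n. \<exists>v. v \<in> W \<and> X n = J v" using X by (auto simp: carr)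
    then obtain Y where Y: "\<And>n. Y n \<in> W" "\<And>n. X n = J (Y n)" by metis
    have "\<exists>l\<in>carrier H. (\<lambda>n. hnorm H (Y n \<ominus> l)) \<longlonglongrightarrow> 0"
      using C by (intro complete) (auto simp: Y Wc mi hn Wd)
    then obtain l where l: "l \<in> carrier H" "(\<lambda>n. hnorm H (Y n \<ominus> l)) \<longlonglongrightarrow> 0" by blast
    then have "l \<in> W" using W Y(1) unfolding closed_submodule_def by blast
    then show "\<exists>l\<in>carrier H'. (\<lambda>n. hnorm H' (X n \<ominus>\<^bsub>H'\<^esub> l)) \<longlonglongrightarrow> 0"
      using l by (intro bexI[of _ "J l"]) (simp_all add: Y mi hn Wd carr)
  next
    show "ip H' y x = cnj (ip H' x y)" if xy: "x \<in> carrier H'" "y \<in> carrier H'" for x y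
    proof -
      obtain v w where "x = J v" "y = J w" "v \<in> W" "w \<in> W"
        using xy unfolding carr by blast
      then show ?thesis using ip_cnj[of v w] by (simp add: ip' Wc)
    qed
  next
    show "x = \<zero>\<^bsub>H'\<^esub>" if x: "x \<in> carrier H'" "ip H' x x = 0" for x
    proof -
      obtain v where v: "x = J v" "v \<in> W"
        using x unfolding carr by blast
      then have "ip H v v = 0" using x by (simp add: ip')
      then show ?thesis using ip_definite[of v] v by (simp add: z Wc)
    qed
  qed (auto simp: carr ad sm ip' Wad Wsm Wc ip_add ip_smult ip_nonneg)
  then show thesis using that carr ip' by blast
qed


section \<open>Herz--Schur multipliers and weak amenability\<close>

definition herz_schur_rep ::
    "('a, 'b) monoid_scheme \<Rightarrow> ('h, 'm) hilbert_scheme \<Rightarrow> ('a \<Rightarrow> complex) \<Rightarrow> ('a \<Rightarrow> 'h) \<Rightarrow> ('a \<Rightarrow> 'h) \<Rightarrow> bool"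
  where "herz_schur_rep G H \<phi> \<xi> \<eta> \<longleftrightarrow>
    complex_hilbert_space H \<and> \<xi> \<in> carrier G \<rightarrow> carrier H \<and> \<eta> \<in> carrier G \<rightarrow> carrier H \<and>
    bdd_above ((\<lambda>x. hnorm H (\<xi> x)) ` carrier G) \<and> bdd_above ((\<lambda>y. hnorm H (\<eta> y)) ` carrier G) \<and>
    (\<forall>x\<in>carrier G. \<forall>y\<in>carrier G. \<phi> (inv\<^bsub>G\<^esub> y \<otimes>\<^bsub>G\<^esub> x) = ip H (\<xi> x) (\<eta> y))"

lemma herz_schur_rep_universe:
  fixes G :: "('a, 'b) monoid_scheme" and H :: "('h, 'm) hilbert_scheme" (structure)
  assumes rep: "herz_schur_rep G H \<phi> \<xi> \<eta>"
  obtains H' :: "('a \<Rightarrow> complex \<times> complex) hilbert" and \<xi>' \<eta>'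
  where "herz_schur_rep G H' \<phi> \<xi>' \<eta>'"
    and "\<And>x. x \<in> carrier G \<Longrightarrow> hnorm H' (\<xi>' x) = hnorm H (\<xi> x)"
    and "\<And>y. y \<in> carrier G \<Longrightarrow> hnorm H' (\<eta>' y) = hnorm H (\<eta> y)"
proof -
  interpret complex_hilbert_space H using rep by (simp add: herz_schur_rep_def)
  define S where "S = \<xi> ` carrier G \<union> \<eta> ` carrier G"
  define F where "F = {U. closed_submodule U \<and> S \<subseteq> U}"
  define W where "W = \<Inter>F"
  define J where "J v = (\<lambda>x. if x \<in> carrier G then (ip H v (\<xi> x), ip H v (\<eta> x)) else (0, 0))" for v
  have SH: "S \<subseteq> carrier H" using rep by (auto simp: S_def herz_schur_rep_def)
  then have "carrier H \<in> F" using closed_submodule_carrier by (simp add: F_def)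
  then have W: "closed_submodule W" "W \<subseteq> carrier H" "S \<subseteq> W"
    by (auto simp: W_def F_def intro!: closed_submodule_Inter)
  have inj: "inj_on J W"
  proof (rule inj_onI)
    fix v w assume vw: "v \<in> W" "w \<in> W" "J v = J w"
    have sub: "submodule W scalars H" using W by (simp add: closed_submodule_def)
    have d: "v \<ominus> w \<in> W" using vw submoduleE(3,5)[OF sub] by (simp add: a_minus_def)
    have c: "v \<in> carrier H" "w \<in> carrier H" "v \<ominus> w \<in> carrier H" using vw d W by blast+
    have "ip H v u = ip H w u" if u: "u \<in> S" for u
    proof -
      obtain x where x: "x \<in> carrier G" "u = \<xi> x \<or> u = \<eta> x" using u by (auto simp: S_def)
      show ?thesis using fun_cong[OF vw(3), of x] x by (auto simp: J_def)
    qed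
    then have "ip H (v \<ominus> w) u = 0" if "u \<in> S" for u
      using that c SH by (subst ip_minus) auto
    then have "S \<subseteq> {u \<in> carrier H. ip H u (v \<ominus> w) = 0}"
      using SH c ip_cnj[of "v \<ominus> w"] by auto
    then have "W \<subseteq> {u \<in> carrier H. ip H u (v \<ominus> w) = 0}"
      using closed_submodule_annihilator[OF c(3)] by (auto simp: W_def F_def)
    then have "v \<ominus> w = \<zero>" using d c ip_definite by blast
    then have "\<ominus> (\<ominus> w) = v" using c by (intro minus_equality) (simp_all add: a_minus_def)
    then show "v = w" using c by simp
  qed
  obtain H' :: "('a \<Rightarrow> complex \<times> complex) hilbert" where H': "complex_hilbert_space H'"
    "carrier H' = J ` W" "\<And>v w. v \<in> W \<Longrightarrow> w \<in> W \<Longrightarrow> ip H' (J v) (J w) = ip H v w"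
    using transport[OF W(1) inj] by metis
  have m: "\<xi> x \<in> W" "\<eta> x \<in> W" if "x \<in> carrier G" for x
    using that W(3) by (auto simp: S_def)
  have n: "hnorm H' (J (\<xi> x)) = hnorm H (\<xi> x)" "hnorm H' (J (\<eta> x)) = hnorm H (\<eta> x)"
    if "x \<in> carrier G" for x
    using that m by (simp_all add: hnorm_def H'(3))
  have "herz_schur_rep G H' \<phi> (J \<circ> \<xi>) (J \<circ> \<eta>)"
    unfolding herz_schur_rep_def
  proof (intro conjI ballI)
    have "(\<lambda>x. hnorm H' ((J \<circ> \<xi>) x)) ` carrier G = (\<lambda>x. hnorm H (\<xi> x)) ` carrier G"
      "(\<lambda>y. hnorm H' ((J \<circ> \<eta>) y)) ` carrier G = (\<lambda>y. hnorm H (\<eta> y)) ` carrier G"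
      using n by (auto intro!: image_cong)
    then show "bdd_above ((\<lambda>x. hnorm H' ((J \<circ> \<xi>) x)) ` carrier G)"
      "bdd_above ((\<lambda>y. hnorm H' ((J \<circ> \<eta>) y)) ` carrier G)"
      using rep by (simp_all add: herz_schur_rep_def)
    show "\<phi> (inv\<^bsub>G\<^esub> y \<otimes>\<^bsub>G\<^esub> x) = ip H' ((J \<circ> \<xi>) x) ((J \<circ> \<eta>) y)"
      if "x \<in> carrier G" "y \<in> carrier G" for x y
      using rep that m by (simp add: herz_schur_rep_def H'(3))
  qed (use H' m in auto)
  then show thesis using that[of H' "J \<circ> \<xi>" "J \<circ> \<eta>"] n by simp
qed

text \<open>HOL cannot quantify over the type underlying a Hilbert space, so in the next two definitions
  \<open>H\<close> ranges over all Hilbert spaces whose elements come from the type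
  \<open>'a \<Rightarrow> complex \<times> complex\<close>. Nothing is lost: lemma \<open>herz_schur_rep_universe\<close> turns a
  representation on a Hilbert space over an arbitrary type into one over this type with the
  same norms.\<close>

definition herz_schur :: "('a, 'b) monoid_scheme \<Rightarrow> ('a \<Rightarrow> complex) set" where
  "herz_schur G =
    {\<phi>. \<exists>(H :: ('a \<Rightarrow> complex \<times> complex) hilbert) \<xi> \<eta>. herz_schur_rep G H \<phi> \<xi> \<eta>}"

definition herz_schur_norm :: "('a, 'b) monoid_scheme \<Rightarrow> ('a \<Rightarrow> complex) \<Rightarrow> real" where
  "herz_schur_norm G \<phi> =
    Inf {(SUP x\<in>carrier G. hnorm H (\<xi> x)) * (SUP y\<in>carrier G. hnorm H (\<eta> y)) |
      (H :: ('a \<Rightarrow> complex \<times> complex) hilbert) \<xi> \<eta>. herz_schur_rep G H \<phi> \<xi> \<eta>}"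

definition weakly_amenable_with :: "('a, 'b) monoid_scheme \<Rightarrow> real \<Rightarrow> bool" where
  "weakly_amenable_with G C \<longleftrightarrow> C \<ge> 1 \<and>
    (\<exists>\<phi> :: nat \<Rightarrow> 'a \<Rightarrow> complex.
      (\<forall>n. finite {x \<in> carrier G. \<phi> n x \<noteq> 0}) \<and>
      (\<forall>x\<in>carrier G. (\<lambda>n. \<phi> n x) \<longlonglongrightarrow> 1) \<and>
      (\<forall>n. \<phi> n \<in> herz_schur G \<and> herz_schur_norm G (\<phi> n) \<le> C))"

definition weakly_amenable :: "('a, 'b) monoid_scheme \<Rightarrow> bool" where
  "weakly_amenable G \<longleftrightarrow> (\<exists>C. weakly_amenable_with G C)"

text \<open>Meaningful only for weakly amenable groups, where the infimum is over a nonempty set.\<close>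

definition cowling_haagerup :: "('a, 'b) monoid_scheme \<Rightarrow> real" where
  "cowling_haagerup G = Inf {C. weakly_amenable_with G C}"


section \<open>Real normed spaces and \<open>L\<^sup>1\<close>\<close>

record 'v normed = "(real, 'v) module" +
  vnorm :: "'v \<Rightarrow> real"

definition closed_subspace :: "'v set \<Rightarrow> ('v, 'm) normed_scheme \<Rightarrow> bool" where
  "closed_subspace E N \<longleftrightarrow> submodule E scalars N \<and>
    (\<forall>X l. (\<forall>n::nat. X n \<in> E) \<and> l \<in> carrier N \<and> (\<lambda>n. vnorm N (X n \<ominus>\<^bsub>N\<^esub> l)) \<longlonglongrightarrow> 0 \<longrightarrow> l \<in> E)"

definition ae_rel :: "'w measure \<Rightarrow> (('w \<Rightarrow> real) \<times> ('w \<Rightarrow> real)) set" where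
  "ae_rel M = {(f, g). integrable M f \<and> integrable M g \<and> (AE x in M. f x = g x)}"

definition L1 :: "'w measure \<Rightarrow> ('w \<Rightarrow> real) set normed" where
  "L1 M = \<lparr>carrier = {f. integrable M f} // ae_rel M,
    mult = undefined, one = undefined,
    zero = ae_rel M `` {\<lambda>x. 0},
    add = (\<lambda>X Y. \<Union>f\<in>X. \<Union>g\<in>Y. ae_rel M `` {\<lambda>x. f x + g x}),
    smult = (\<lambda>c X. \<Union>f\<in>X. ae_rel M `` {\<lambda>x. c * f x}),
    vnorm = (\<lambda>X. the_elem ((\<lambda>f. \<integral>x. \<bar>f x\<bar> \<partial>M) ` X))\<rparr>"

lemma equiv_ae_rel: "equiv {f. integrable M f} (ae_rel M)"
  by (rule equivI) (auto simp: ae_rel_def refl_on_def sym_def trans_def elim: AE_mp)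

definition L1_class :: "'w measure \<Rightarrow> ('w \<Rightarrow> real) \<Rightarrow> ('w \<Rightarrow> real) set" where
  "L1_class M f = ae_rel M `` {f}"

lemma L1_class_eq_iff:
  assumes "integrable M f" "integrable M g"
  shows "L1_class M f = L1_class M g \<longleftrightarrow> (AE x in M. f x = g x)"
  unfolding L1_class_def using eq_equiv_class_iff[OF equiv_ae_rel, of f M g] assms
  by (simp add: ae_rel_def)

lemma carrier_L1: "carrier (L1 M) = L1_class M ` {f. integrable M f}"
  by (auto simp: L1_def L1_class_def quotient_def)

lemma zero_L1: "\<zero>\<^bsub>L1 M\<^esub> = L1_class M (\<lambda>x. 0)"
  by (simp add: L1_def L1_class_def)

lemma add_L1:
  assumes "integrable M f" "integrable M g"
  shows "L1_class M f \<oplus>\<^bsub>L1 M\<^esub> L1_class M g = L1_class M (\<lambda>x. f x + g x)"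
proof -
  have *: "ae_rel M `` {\<lambda>x. f' x + g' x} = L1_class M (\<lambda>x. f x + g x)"
    if "f' \<in> ae_rel M `` {f}" "g' \<in> ae_rel M `` {g}" for f' g'
    using that unfolding L1_class_def[symmetric]
    by (subst L1_class_eq_iff) (auto simp: ae_rel_def L1_class_def elim: AE_mp)
  have "f \<in> ae_rel M `` {f}" "g \<in> ae_rel M `` {g}"
    using assms by (auto simp: ae_rel_def)
  then show ?thesis
    by (auto simp: L1_def L1_class_def[of M f] L1_class_def[of M g] *)
qed

lemma smult_L1:
  assumes "integrable M f"
  shows "c \<odot>\<^bsub>L1 M\<^esub> L1_class M f = L1_class M (\<lambda>x. c * f x)"
proof -
  have *: "ae_rel M `` {\<lambda>x. c * f' x} = L1_class M (\<lambda>x. c * f x)"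
    if "f' \<in> ae_rel M `` {f}" for f'
    using that unfolding L1_class_def[symmetric]
    by (subst L1_class_eq_iff) (auto simp: ae_rel_def L1_class_def simp del: mult_cancel_left elim: eventually_mono)
  have "f \<in> ae_rel M `` {f}"
    using assms by (auto simp: ae_rel_def)
  then show ?thesis
    by (auto simp: L1_def L1_class_def[of M f] *)
qed

lemma vnorm_L1:
  assumes "integrable M f"
  shows "vnorm (L1 M) (L1_class M f) = (\<integral>x. \<bar>f x\<bar> \<partial>M)"
proof -
  have "(\<integral>x. \<bar>f' x\<bar> \<partial>M) = (\<integral>x. \<bar>f x\<bar> \<partial>M)" if "f' \<in> ae_rel M `` {f}" for f'
    using that by (intro integral_cong_AE) (auto simp: ae_rel_def elim: AE_mp)
  moreover have "f \<in> ae_rel M `` {f}"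
    using assms by (auto simp: ae_rel_def)
  ultimately have "(\<lambda>f. \<integral>x. \<bar>f x\<bar> \<partial>M) ` (ae_rel M `` {f}) = {\<integral>x. \<bar>f x\<bar> \<partial>M}"
    by blast
  then show ?thesis
    by (simp add: L1_def L1_class_def)
qed

lemma module_L1: "module scalars (L1 M)"
proof (rule moduleI[OF cring_scalars])
  show "abelian_group (L1 M)"
  proof (rule abelian_groupI)
    fix X assume "X \<in> carrier (L1 M)"
    then obtain f where f: "integrable M f" "X = L1_class M f"
      by (auto simp: carrier_L1)
    have "L1_class M (\<lambda>x. - f x) \<oplus>\<^bsub>L1 M\<^esub> X = \<zero>\<^bsub>L1 M\<^esub>"
      using f by (simp add: add_L1 zero_L1)
    then show "\<exists>Y\<in>carrier (L1 M). Y \<oplus>\<^bsub>L1 M\<^esub> X = \<zero>\<^bsub>L1 M\<^esub>"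
      using f by (auto simp: carrier_L1)
  qed (auto simp: carrier_L1 zero_L1 add_L1 algebra_simps intro!: imageI)
qed (auto simp: carrier_L1 add_L1 smult_L1 algebra_simps intro!: imageI)

lemma minus_L1:
  assumes "integrable M f" "integrable M g"
  shows "L1_class M f \<ominus>\<^bsub>L1 M\<^esub> L1_class M g = L1_class M (\<lambda>x. f x - g x)"
proof -
  interpret module scalars "L1 M" by (rule module_L1)
  have "\<ominus>\<^bsub>L1 M\<^esub> L1_class M g = L1_class M (\<lambda>x. - g x)"
    by (rule minus_equality) (use assms in \<open>auto simp: carrier_L1 zero_L1 add_L1\<close>)
  then show ?thesis
    using assms by (simp add: a_minus_def add_L1)
qed

text \<open>A measure on an arbitrary type can be replaced by one on \<open>nat \<Rightarrow> real\<close> when only a separable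
  closed subspace \<open>E\<close> of its \<open>L\<^sup>1\<close> matters: for representatives \<open>f\<^sub>n\<close> of a dense sequence of \<open>E\<close>,
  pushing the measure forward along \<open>\<omega> \<mapsto> (f\<^sub>n \<omega>)\<^sub>n\<close> carries \<open>E\<close> isometrically onto a closed
  subspace. For an affine action of a countable group, the closed linear span of the values of
  the cocycle is invariant and separable, so existence over \<open>nat \<Rightarrow> real\<close> is the same as existence
  over any measure space.\<close>


section \<open>Affine actions\<close>

definition bounded_linear_on :: "('v, 'm) normed_scheme \<Rightarrow> ('v \<Rightarrow> 'v) \<Rightarrow> bool" where
  "bounded_linear_on N T \<longleftrightarrow> T \<in> carrier N \<rightarrow> carrier N \<and>
    (\<forall>v\<in>carrier N. \<forall>w\<in>carrier N. T (v \<oplus>\<^bsub>N\<^esub> w) = T v \<oplus>\<^bsub>N\<^esub> T w) \<and>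
    (\<forall>c. \<forall>v\<in>carrier N. T (c \<odot>\<^bsub>N\<^esub> v) = c \<odot>\<^bsub>N\<^esub> T v) \<and>
    (\<exists>K. \<forall>v\<in>carrier N. vnorm N (T v) \<le> K * vnorm N v)"

definition GL :: "('v, 'm) normed_scheme \<Rightarrow> ('v \<Rightarrow> 'v) monoid" where
  "GL N = (BijGroup (carrier N))\<lparr>carrier :=
    {T \<in> Bij (carrier N). bounded_linear_on N T \<and> bounded_linear_on N (inv_into (carrier N) T)}\<rparr>"

definition affine_action ::
    "('a, 'b) monoid_scheme \<Rightarrow> ('v, 'm) normed_scheme \<Rightarrow> ('a \<Rightarrow> 'v \<Rightarrow> 'v) \<Rightarrow> ('a \<Rightarrow> 'v) \<Rightarrow> bool"
  where "affine_action G N \<pi> b \<longleftrightarrow> \<pi> \<in> hom G (GL N) \<and> b \<in> carrier G \<rightarrow> carrier N \<and>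
    (\<forall>s\<in>carrier G. \<forall>t\<in>carrier G. b (s \<otimes>\<^bsub>G\<^esub> t) = \<pi> s (b t) \<oplus>\<^bsub>N\<^esub> b s)"

definition affine_map ::
    "('v, 'm) normed_scheme \<Rightarrow> ('a \<Rightarrow> 'v \<Rightarrow> 'v) \<Rightarrow> ('a \<Rightarrow> 'v) \<Rightarrow> 'a \<Rightarrow> 'v \<Rightarrow> 'v" where
  "affine_map N \<pi> b s v = \<pi> s v \<oplus>\<^bsub>N\<^esub> b s"

definition uniformly_lipschitz ::
    "('a, 'b) monoid_scheme \<Rightarrow> ('v, 'm) normed_scheme \<Rightarrow> ('a \<Rightarrow> 'v \<Rightarrow> 'v) \<Rightarrow> bool" where
  "uniformly_lipschitz G N \<sigma> \<longleftrightarrow>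
    (\<exists>C\<ge>1. \<forall>s\<in>carrier G. \<forall>v\<in>carrier N. \<forall>w\<in>carrier N.
      vnorm N (\<sigma> s v \<ominus>\<^bsub>N\<^esub> \<sigma> s w) \<le> C * vnorm N (v \<ominus>\<^bsub>N\<^esub> w))"

definition proper_action ::
    "('a, 'b) monoid_scheme \<Rightarrow> ('v, 'm) normed_scheme \<Rightarrow> ('a \<Rightarrow> 'v \<Rightarrow> 'v) \<Rightarrow> bool" where
  "proper_action G N \<sigma> \<longleftrightarrow>
    (\<forall>v\<in>carrier N. \<forall>R>0. finite {s \<in> carrier G. vnorm N (\<sigma> s v \<ominus>\<^bsub>N\<^esub> v) \<le> R})"

end

theory Submission
  imports Defs "HOL-Probability.Probability"
begin

text \<open>A representation \<open>\<phi>(y\<inverse>x) = \<langle>\<xi>(x), \<eta>(y)\<rangle>\<close> with \<open>R = (\<xi> + \<eta>) / 2\<close>, \<open>S = (\<xi> - \<eta>) / 2\<close> and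
  \<open>p(g) = Re (\<phi>(g) + \<phi>(g\<inverse>)) / 2\<close> gives
  \<open>Re \<langle>R(x), R(y)\<rangle> = p(y\<inverse>x) + Re \<langle>S(x), S(y)\<rangle>\<close>. If \<open>\<parallel>\<phi>\<parallel>\<close> and \<open>\<phi>(1)\<close> are close to 1, then,
  after balancing \<open>\<xi>\<close> against \<open>\<eta>\<close>, \<open>S\<close> is uniformly small. Choose finitely supported
  \<open>\<phi>\<^sub>n \<rightarrow> 1\<close> fast and let \<open>k\<close> be the sum over \<open>n\<close> of the Gram kernels of
  \<open>x \<mapsto> R\<^sub>n(x) - R\<^sub>n(1)\<close>. Then \<open>k(x, x)\<close> tends to infinity, because every \<open>p\<^sub>n\<close> has finite support,
  and for finitely supported \<open>f\<close> of sum zero the quadratic form \<open>Q(f) = \<Sum> f(x) f(y) k(x, y)\<close>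
  differs from an invariant one by at most \<open>\<parallel>f\<parallel>\<^sub>1\<^sup>2\<close>, the contribution of the \<open>S\<^sub>n\<close>.

  Hence left translations are uniformly bounded for the norm \<open>c \<surd>Q(f) + \<parallel>f\<parallel>\<^sub>1\<close>, and the cocycle
  \<open>b(s) = \<delta>\<^sub>s - \<delta>\<^sub>1\<close> is proper. This norm is an \<open>L\<^sup>1\<close> norm: the first term is the \<open>L\<^sup>1\<close> norm of a
  centred Gaussian variable of variance \<open>Q(f)\<close>, the second one lives on a disjoint purely atomic
  part. The action extends to the closure.\<close>

section \<open>Positive semidefinite kernels\<close>

text \<open>Over the reals, nonnegativity of the quadratic forms does not force symmetry, so
  symmetry is a separate clause.\<close>

definition psd_on :: "'a set \<Rightarrow> ('a \<Rightarrow> 'a \<Rightarrow> real) \<Rightarrow> bool" where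
  "psd_on X k \<longleftrightarrow> (\<forall>x\<in>X. \<forall>y\<in>X. k x y = k y x) \<and>
    (\<forall>A f. finite A \<and> A \<subseteq> X \<longrightarrow> 0 \<le> (\<Sum>x\<in>A. \<Sum>y\<in>A. f x * f y * k x y))"

lemma psd_onI:
  assumes "\<And>x y. x \<in> X \<Longrightarrow> y \<in> X \<Longrightarrow> k x y = k y x"
    and "\<And>A f. finite A \<Longrightarrow> A \<subseteq> X \<Longrightarrow> 0 \<le> (\<Sum>x\<in>A. \<Sum>y\<in>A. f x * f y * k x y)"
  shows "psd_on X k"
  using assms by (simp add: psd_on_def)

lemma psd_on_sym: "psd_on X k \<Longrightarrow> x \<in> X \<Longrightarrow> y \<in> X \<Longrightarrow> k x y = k y x"
  by (simp add: psd_on_def)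

lemma psd_on_nonneg:
  "psd_on X k \<Longrightarrow> finite A \<Longrightarrow> A \<subseteq> X \<Longrightarrow> 0 \<le> (\<Sum>x\<in>A. \<Sum>y\<in>A. f x * f y * k x y)"
  by (simp add: psd_on_def)

text \<open>Coefficients are summed over the fibres of \<open>h\<close>. As \<open>h\<close> may
  repeat values, one point of \<open>X\<close> can occur under several indices.\<close>

lemma psd_on_map:
  assumes k: "psd_on X k" and h: "h \<in> I \<rightarrow> X"
  shows "psd_on I (\<lambda>i j. k (h i) (h j))"
proof (rule psd_onI)
  show "k (h i) (h j) = k (h j) (h i)" if "i \<in> I" "j \<in> I" for i j
    using h that by (intro psd_on_sym[OF k]) auto
  fix A and f :: "'b \<Rightarrow> real" assume A: "finite A" "A \<subseteq> I"
  define F where "F a = (\<Sum>i\<in>{i\<in>A. h i = a}. f i)" for a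
  have push: "(\<Sum>i\<in>A. f i * u (h i)) = (\<Sum>a\<in>h ` A. F a * u a)" for u :: "'a \<Rightarrow> real"
    unfolding F_def sum_distrib_right by (subst sum.image_gen[OF A(1), of _ h]) (auto intro!: sum.cong)
  have "(\<Sum>i\<in>A. \<Sum>j\<in>A. f i * f j * k (h i) (h j)) = (\<Sum>i\<in>A. f i * (\<Sum>j\<in>A. f j * k (h i) (h j)))"
    by (simp add: sum_distrib_left mult.assoc)
  also have "\<dots> = (\<Sum>i\<in>A. f i * (\<Sum>b\<in>h ` A. F b * k (h i) b))"
    by (simp add: push)
  also have "\<dots> = (\<Sum>a\<in>h ` A. F a * (\<Sum>b\<in>h ` A. F b * k a b))"
    by (rule push)
  also have "\<dots> = (\<Sum>a\<in>h ` A. \<Sum>b\<in>h ` A. F a * F b * k a b)"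
    by (simp add: sum_distrib_left mult.assoc)
  also have "\<dots> \<ge> 0"
    using A h by (intro psd_on_nonneg[OF k]) auto
  finally show "0 \<le> (\<Sum>i\<in>A. \<Sum>j\<in>A. f i * f j * k (h i) (h j))" .
qed

text \<open>The form is evaluated on \<open>f\<close> plus \<open>t\<close> times the point mass at
  \<open>e\<close>. Since \<open>e\<close> may already lie in \<open>A\<close>, a disjoint sum of
  index sets keeps the new copy apart. Later inequalities follow by choosing
  \<open>t\<close>.\<close>

lemma psd_on_adjoin:
  assumes k: "psd_on X k" and A: "finite A" "A \<subseteq> X" and e: "e \<in> X"
  shows "0 \<le> (\<Sum>x\<in>A. \<Sum>y\<in>A. f x * f y * k x y) + 2 * t * (\<Sum>x\<in>A. f x * k x e) + t\<^sup>2 * k e e"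
proof -
  let ?h = "case_sum id (\<lambda>_. e) :: 'a + unit \<Rightarrow> 'a" and ?g = "case_sum f (\<lambda>_. t) :: 'a + unit \<Rightarrow> real"
  have "psd_on (X <+> {()}) (\<lambda>i j. k (?h i) (?h j))"
    using e by (intro psd_on_map[OF k]) auto
  from psd_on_nonneg[OF this, of "A <+> {()}" ?g]
  have "0 \<le> (\<Sum>i\<in>A <+> {()}. \<Sum>j\<in>A <+> {()}. ?g i * ?g j * k (?h i) (?h j))"
    using A by auto
  also have "\<dots> = (\<Sum>x\<in>A. \<Sum>y\<in>A. f x * f y * k x y) + (\<Sum>x\<in>A. f x * t * k x e)
      + ((\<Sum>y\<in>A. t * f y * k e y) + t * t * k e e)"
    using A by (simp add: sum.Plus sum.distrib)
  also have "(\<Sum>y\<in>A. t * f y * k e y) = (\<Sum>x\<in>A. f x * t * k x e)"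
    using A e psd_on_sym[OF k] by (intro sum.cong) auto
  also have "(\<Sum>x\<in>A. f x * t * k x e) = t * (\<Sum>x\<in>A. f x * k x e)"
    by (simp add: sum_distrib_left mult_ac)
  finally show ?thesis by (simp add: power2_eq_square algebra_simps)
qed

lemma psd_on_diag: "psd_on X k \<Longrightarrow> x \<in> X \<Longrightarrow> 0 \<le> k x x"
  using psd_on_nonneg[of X k "{x}" "\<lambda>_. 1"] by simp

text \<open>Polarisation: the form is nonnegative on the sum and on the difference of two point
  masses.\<close>

lemma psd_on_abs_le:
  assumes k: "psd_on X k" and "x \<in> X" "y \<in> X"
  shows "2 * \<bar>k x y\<bar> \<le> k x x + k y y"
  using psd_on_adjoin[OF k, of "{x}" y "\<lambda>_. 1" 1] psd_on_adjoin[OF k, of "{x}" y "\<lambda>_. 1" "-1"] assms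
  by simp

text \<open>The polynomial in \<open>t\<close> supplied by \<open>psd_on_adjoin\<close> is
  nonnegative everywhere, in particular at its minimum.\<close>

lemma psd_on_cauchy_schwarz:
  assumes k: "psd_on X k" and A: "finite A" "A \<subseteq> X" and e: "e \<in> X"
  shows "(\<Sum>x\<in>A. f x * k x e)\<^sup>2 \<le> (\<Sum>x\<in>A. \<Sum>y\<in>A. f x * f y * k x y) * k e e"
    (is "?L\<^sup>2 \<le> ?Q * _")
proof -
  note ad = psd_on_adjoin[OF k A e, of f]
  show ?thesis
  proof (cases "k e e = 0")
    case False
    then have pos: "k e e > 0" using psd_on_diag[OF k e] by simp
    \<comment> \<open>The minimiser of the quadratic polynomial in \<open>t\<close>.\<close>
    have "0 \<le> ?Q + 2 * (- ?L / k e e) * ?L + (- ?L / k e e)\<^sup>2 * k e e" by (rule ad)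
    also have "\<dots> = ?Q - ?L\<^sup>2 / k e e"
      using pos by (simp add: power2_eq_square field_simps)
    finally show ?thesis using pos by (simp add: field_simps)
  next
    case True
    have "?L = 0"
    proof (rule ccontr)
      assume L: "?L \<noteq> 0"
      \<comment> \<open>Without quadratic term the polynomial is affine in \<open>t\<close> with
        slope \<open>2 * ?L\<close>; this \<open>t\<close> gives it the value -1.\<close>
      have "0 \<le> ?Q + 2 * (- (?Q + 1) / (2 * ?L)) * ?L + (- (?Q + 1) / (2 * ?L))\<^sup>2 * k e e"
        by (rule ad)
      also have "\<dots> = -1" using True L by (simp add: field_simps)
      finally show False by simp
    qed
    then show ?thesis using True by simp
  qed
qed

lemma psd_on_cong:
  assumes "psd_on X k" "\<And>x y. x \<in> X \<Longrightarrow> y \<in> X \<Longrightarrow> k x y = k' x y"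
  shows "psd_on X k'"
proof (rule psd_onI)
  fix A and f :: "'a \<Rightarrow> real" assume A: "finite A" "A \<subseteq> X"
  have "(\<Sum>x\<in>A. \<Sum>y\<in>A. f x * f y * k' x y) = (\<Sum>x\<in>A. \<Sum>y\<in>A. f x * f y * k x y)"
    using A assms(2) by (intro sum.cong) (auto simp: subset_iff)
  then show "0 \<le> (\<Sum>x\<in>A. \<Sum>y\<in>A. f x * f y * k' x y)"
    using psd_on_nonneg[OF assms(1) A] by simp
qed (use assms psd_on_sym[OF assms(1)] in metis)

text \<open>For a Gram kernel this projects onto the orthogonal complement of the vector at
  \<open>e\<close>; nonnegativity is the Cauchy-Schwarz inequality. If \<open>k e e = 0\<close>, the
  quotient is 0 by convention.\<close>

lemma psd_on_schur_complement:
  assumes k: "psd_on X k" and e: "e \<in> X"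
  shows "psd_on X (\<lambda>x y. k x y - k x e * k y e / k e e)"
proof (rule psd_onI)
  fix A and f :: "'a \<Rightarrow> real" assume A: "finite A" "A \<subseteq> X"
  let ?Q = "\<Sum>x\<in>A. \<Sum>y\<in>A. f x * f y * k x y" and ?L = "\<Sum>x\<in>A. f x * k x e"
  have "(\<Sum>x\<in>A. \<Sum>y\<in>A. f x * f y * (k x y - k x e * k y e / k e e)) = ?Q - ?L\<^sup>2 / k e e"
    by (simp add: power2_eq_square sum_product sum_divide_distrib sum_subtractf[symmetric] algebra_simps)
  moreover have "?L\<^sup>2 / k e e \<le> ?Q"
    using psd_on_cauchy_schwarz[OF k A e, of f] psd_on_diag[OF k e] psd_on_nonneg[OF k A, of f]
    by (cases "k e e = 0") (auto simp: divide_le_eq)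
  ultimately show "0 \<le> (\<Sum>x\<in>A. \<Sum>y\<in>A. f x * f y * (k x y - k x e * k y e / k e e))" by simp
qed (use psd_on_sym[OF k] in \<open>simp add: mult.commute\<close>)

text \<open>For the Gram kernel of \<open>v\<close> this is the Gram kernel of
  \<open>v x - v e\<close>. Adjoining \<open>e\<close> with coefficient \<open>- sum f A\<close>
  makes the total coefficient zero.\<close>

lemma psd_on_centre:
  assumes k: "psd_on X k" and e: "e \<in> X"
  shows "psd_on X (\<lambda>x y. k x y - k x e - k e y + k e e)"
proof (rule psd_onI)
  fix A and f :: "'a \<Rightarrow> real" assume A: "finite A" "A \<subseteq> X"
  let ?L = "\<Sum>x\<in>A. f x * k x e"
  have "0 \<le> (\<Sum>x\<in>A. \<Sum>y\<in>A. f x * f y * k x y) + 2 * (- sum f A) * ?L + (- sum f A)\<^sup>2 * k e e"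
    by (rule psd_on_adjoin[OF k A e])
  also have "\<dots> = (\<Sum>x\<in>A. \<Sum>y\<in>A. f x * f y * (k x y - k x e - k y e + k e e))"
  proof -
    have e1: "sum f A * ?L = (\<Sum>x\<in>A. \<Sum>y\<in>A. f x * f y * k y e)"
      by (simp add: sum_product mult.assoc)
    moreover have "sum f A * ?L = (\<Sum>x\<in>A. \<Sum>y\<in>A. f x * f y * k x e)"
      unfolding e1 by (subst sum.swap) (simp add: mult.commute)
    moreover have "(sum f A)\<^sup>2 * k e e = (\<Sum>x\<in>A. \<Sum>y\<in>A. f x * f y * k e e)"
      by (simp only: power2_eq_square sum_product) (simp add: sum_distrib_right)
    ultimately have "(\<Sum>x\<in>A. \<Sum>y\<in>A. f x * f y * k x y) - sum f A * ?L - sum f A * ?L + (sum f A)\<^sup>2 * k e e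
      = (\<Sum>x\<in>A. \<Sum>y\<in>A. f x * f y * k x y - f x * f y * k x e - f x * f y * k y e + f x * f y * k e e)"
      by (simp add: sum.distrib sum_subtractf)
    then show ?thesis
      by (simp add: right_diff_distrib distrib_left)
  qed
  also have "\<dots> = (\<Sum>x\<in>A. \<Sum>y\<in>A. f x * f y * (k x y - k x e - k e y + k e e))"
    using A psd_on_sym[OF k] e by (intro sum.cong) (auto simp: subset_iff)
  finally show "0 \<le> (\<Sum>x\<in>A. \<Sum>y\<in>A. f x * f y * (k x y - k x e - k e y + k e e))" .
qed (use psd_on_sym[OF k] e in simp)

text \<open>Symmetric Gaussian elimination. A vanishing pivot needs no case distinction: its whole row
  vanishes by positivity, and the junk value \<open>x / 0 = 0\<close> leaves the kernel unchanged.\<close>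

fun pivot :: "(nat \<Rightarrow> nat \<Rightarrow> real) \<Rightarrow> nat \<Rightarrow> nat \<Rightarrow> nat \<Rightarrow> real" where
  "pivot k 0 = k"
| "pivot k (Suc j) = (\<lambda>m n. pivot k j m n - pivot k j m j * pivot k j n j / pivot k j j j)"

lemma psd_on_pivot: "psd_on UNIV k \<Longrightarrow> psd_on UNIV (pivot k j)"
  by (induction j) (auto intro: psd_on_schur_complement)

text \<open>Step \<open>j\<close> clears row \<open>j\<close>. Rows cleared before stay zero,
  because the correction of an entry contains a factor from the same row.\<close>

lemma pivot_eq_0:
  assumes "psd_on UNIV k" "m < j"
  shows "pivot k j m n = 0"
  using assms(2)
proof (induction j arbitrary: m n)
  case (Suc j)
  have psd: "psd_on UNIV (pivot k j)" using assms(1) by (rule psd_on_pivot)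
  show ?case
  proof (cases "m = j")
    case True
    have "(pivot k j j n)\<^sup>2 \<le> pivot k j j j * pivot k j n n"
      using psd_on_cauchy_schwarz[OF psd, of "{j}" n "\<lambda>_. 1"] by simp
    then have "pivot k j j j = 0 \<Longrightarrow> pivot k j j n = 0" by simp
    then show ?thesis using True psd_on_sym[OF psd, of j n] by auto
  qed (use Suc in simp)
qed simp

text \<open>An infinite Cholesky factorisation. The remainder after \<open>N\<close> steps vanishes
  in all rows with index less than \<open>N\<close>, so finite sums are exact. Triangularity makes
  each row a finite coefficient vector, ready for a finite combination of Gaussians.\<close>

lemma psd_on_nat_cholesky:
  assumes k: "psd_on UNIV k"
  obtains a :: "nat \<Rightarrow> nat \<Rightarrow> real"
  where "\<And>m n N. m < N \<Longrightarrow> k m n = (\<Sum>j<N. a m j * a n j)" and "\<And>m j. m < j \<Longrightarrow> a m j = 0"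
proof -
  \<comment> \<open>A zero pivot gives a zero column, since division by zero yields 0.\<close>
  define a where "a m j = pivot k j m j / sqrt (pivot k j j j)" for m j
  have *: "k m n = (\<Sum>j<N. a m j * a n j) + pivot k N m n" for m n N
  proof (induction N)
    case (Suc N)
    have "pivot k N N N \<ge> 0" using psd_on_diag[OF psd_on_pivot[OF k]] by simp
    then have "a m N * a n N = pivot k N m N * pivot k N n N / pivot k N N N"
      by (simp add: a_def)
    then show ?case using Suc by simp
  qed simp
  have "k m n = (\<Sum>j<N. a m j * a n j)" if "m < N" for m n N
    using *[of m n N] pivot_eq_0[OF k that] by simp
  moreover have "a m j = 0" if "m < j" for m j
    using pivot_eq_0[OF k that] by (simp add: a_def)
  ultimately show thesis by (rule that)
qed


section \<open>Kernels from Herz--Schur multipliers\<close>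

text \<open>The form is the squared norm of the linear combination \<open>w\<close>, which is built
  by induction and described only through its inner products.\<close>

lemma (in complex_hilbert_space) gram_nonneg:
  assumes "finite A" and "\<And>x. x \<in> A \<Longrightarrow> v x \<in> carrier H"
  shows "0 \<le> (\<Sum>x\<in>A. \<Sum>y\<in>A. f x * f y * Re (ip H (v x) (v y)))"
proof -
  have "\<exists>w\<in>carrier H. \<forall>u\<in>carrier H. ip H w u = (\<Sum>x\<in>A. complex_of_real (f x) * ip H (v x) u)"
    using assms
  proof (induction A rule: finite_induct)
    case empty
    then show ?case by (intro bexI[of _ "\<zero>"]) (auto simp: ip_zero)
  next
    case (insert a A)
    then obtain w where w: "w \<in> carrier H"
      "\<And>u. u \<in> carrier H \<Longrightarrow> ip H w u = (\<Sum>x\<in>A. complex_of_real (f x) * ip H (v x) u)"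
      by auto
    then show ?case
      using insert by (intro bexI[of _ "complex_of_real (f a) \<odot> v a \<oplus> w"]) (auto simp: ip_add ip_smult)
  qed
  then obtain w where w: "w \<in> carrier H"
      "\<And>u. u \<in> carrier H \<Longrightarrow> ip H w u = (\<Sum>x\<in>A. complex_of_real (f x) * ip H (v x) u)"
    by auto
  have "ip H w w = (\<Sum>x\<in>A. complex_of_real (f x) * cnj (ip H w (v x)))"
    using w assms ip_cnj[of w] by (subst w(2)) auto
  also have "\<dots> = (\<Sum>x\<in>A. complex_of_real (f x) * (\<Sum>y\<in>A. complex_of_real (f y) * cnj (ip H (v y) (v x))))"
    using w assms by (intro sum.cong) auto
  also have "\<dots> = (\<Sum>x\<in>A. \<Sum>y\<in>A. complex_of_real (f x * f y) * ip H (v x) (v y))"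
    using assms by (auto simp: sum_distrib_left mult.assoc intro!: sum.cong ip_cnj[symmetric])
  finally have "Re (ip H w w) = (\<Sum>x\<in>A. \<Sum>y\<in>A. f x * f y * Re (ip H (v x) (v y)))"
    by simp
  then show ?thesis using ip_nonneg[OF w(1)] by simp
qed

lemma (in complex_hilbert_space) psd_on_gram:
  assumes "\<And>x. x \<in> X \<Longrightarrow> v x \<in> carrier H"
  shows "psd_on X (\<lambda>x y. Re (ip H (v x) (v y)))"
proof (rule psd_onI)
  show "Re (ip H (v x) (v y)) = Re (ip H (v y) (v x))" if "x \<in> X" "y \<in> X" for x y
    using ip_cnj[of "v y" "v x"] assms that by simp
qed (use assms in \<open>auto intro!: gram_nonneg\<close>)

text \<open>With \<open>u = t\<^sup>2\<close>, the arithmetic-geometric mean inequality is sharp at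
  \<open>u = b / a\<close>, with value \<open>2 * a * b\<close>. If \<open>a\<close> or
  \<open>b\<close> vanishes, \<open>C > 0\<close> leaves room for a suitably large or small
  \<open>u\<close>.\<close>

lemma exists_balancing_scale:
  fixes a b C :: real
  assumes "0 \<le> a" "0 \<le> b" "a * b < C"
  obtains t where "t > 0" "t\<^sup>2 * a\<^sup>2 + b\<^sup>2 / t\<^sup>2 \<le> 2 * C"
proof -
  have C: "C > 0" using assms by (meson le_less_trans mult_nonneg_nonneg)
  have "\<exists>u>0. u * a\<^sup>2 + b\<^sup>2 / u \<le> 2 * C"
  proof (cases "a = 0 \<or> b = 0")
    case True
    then show ?thesis
    proof
      assume a: "a = 0"
      \<comment> \<open>The first summand of \<open>u\<close> brings \<open>b\<^sup>2 / u\<close>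
        below \<open>2 * C\<close>; the 1 keeps \<open>u\<close> positive when
        \<open>b = 0\<close>.\<close>
      have "b\<^sup>2 \<le> 2 * C * (b\<^sup>2 / (2 * C) + 1)" using C by (simp add: field_simps)
      then show ?thesis
        using C a by (intro exI[of _ "b\<^sup>2 / (2 * C) + 1"]) (auto simp: divide_le_eq add_nonneg_pos)
    next
      assume b: "b = 0"
      have "a\<^sup>2 \<le> 2 * C * (a\<^sup>2 / (2 * C) + 1)" using C by (simp add: field_simps)
      then show ?thesis
        using C b by (intro exI[of _ "1 / (a\<^sup>2 / (2 * C) + 1)"]) (auto simp: divide_le_eq add_nonneg_pos)
    qed
  next
    case False
    then show ?thesis
      using assms by (intro exI[of _ "b / a"]) (auto simp: power2_eq_square)
  qed
  then obtain u where u: "u > 0" "u * a\<^sup>2 + b\<^sup>2 / u \<le> 2 * C" by blast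
  then show thesis by (intro that[of "sqrt u"]) auto
qed

text \<open>Polarisation: the Gram kernels of the rescaled half-sum and half-difference of
  \<open>\<xi>\<close> and \<open>\<eta>\<close> differ by the symmetrised real part of
  \<open>\<phi>\<close>. The kernel \<open>s\<close> is that of the half-difference.\<close>

lemma herz_schur_kernel:
  fixes G :: "('a, 'b) monoid_scheme"
  assumes G: "group G" and \<phi>: "\<phi> \<in> herz_schur G" "herz_schur_norm G \<phi> < C"
  obtains s where "psd_on (carrier G) s"
    and "psd_on (carrier G) (\<lambda>x y.
      Re (\<phi> (inv\<^bsub>G\<^esub> y \<otimes>\<^bsub>G\<^esub> x) + \<phi> (inv\<^bsub>G\<^esub> x \<otimes>\<^bsub>G\<^esub> y)) / 2 + s x y)"
    and "\<And>x. x \<in> carrier G \<Longrightarrow> s x x \<le> (C - Re (\<phi> \<one>\<^bsub>G\<^esub>)) / 2"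
proof -
  interpret G: group G by fact
  \<comment> \<open>Membership makes the set under the infimum nonempty, so an actual representation
    meets the strict bound.\<close>
  obtain H :: "('a \<Rightarrow> complex \<times> complex) hilbert" and \<xi> \<eta> where
    rep: "herz_schur_rep G H \<phi> \<xi> \<eta>"
    and less: "(SUP x\<in>carrier G. hnorm H (\<xi> x)) * (SUP y\<in>carrier G. hnorm H (\<eta> y)) < C"
    using cInf_lessD[OF _ \<phi>(2)[unfolded herz_schur_norm_def]] \<phi>(1)
    by (fastforce simp: herz_schur_def)
  interpret H: complex_hilbert_space H using rep by (simp add: herz_schur_rep_def)
  define A where "A = (SUP x\<in>carrier G. hnorm H (\<xi> x))"
  define B where "B = (SUP x\<in>carrier G. hnorm H (\<eta> x))"
  have c: "\<xi> x \<in> carrier H" "\<eta> x \<in> carrier H" if "x \<in> carrier G" for x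
    using rep that by (auto simp: herz_schur_rep_def)
  have h0: "hnorm H (\<xi> x) \<ge> 0" "hnorm H (\<eta> x) \<ge> 0" if "x \<in> carrier G" for x
    using c[OF that] H.ip_nonneg by (auto simp: hnorm_def)
  have hA: "hnorm H (\<xi> x) \<le> A" and hB: "hnorm H (\<eta> x) \<le> B" if "x \<in> carrier G" for x
    using rep that unfolding A_def B_def herz_schur_rep_def by (auto intro: cSUP_upper)
  have "A \<ge> 0" "B \<ge> 0" using h0[of "\<one>\<^bsub>G\<^esub>"] hA[of "\<one>\<^bsub>G\<^esub>"] hB[of "\<one>\<^bsub>G\<^esub>"] by auto
  then obtain t where t: "t > 0" "t\<^sup>2 * A\<^sup>2 + B\<^sup>2 / t\<^sup>2 \<le> 2 * C"
    using less by (auto simp: A_def B_def intro: exists_balancing_scale)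
  \<comment> \<open>The values \<open>b = 1 / (2 * t)\<close> and \<open>b = - 1 / (2 * t)\<close>
    give the half-sum and half-difference of \<open>t \<xi>\<close> and \<open>\<eta> / t\<close>; a
    free \<open>b\<close> lets one expansion serve both.\<close>
  define v where "v b x = complex_of_real (t / 2) \<odot>\<^bsub>H\<^esub> \<xi> x \<oplus>\<^bsub>H\<^esub> complex_of_real b \<odot>\<^bsub>H\<^esub> \<eta> x" for b x
  have v: "v b x \<in> carrier H" if "x \<in> carrier G" for b x
    using c[OF that] by (simp add: v_def)
  have gram: "Re (ip H (v b x) (v b y)) = t\<^sup>2 / 4 * Re (ip H (\<xi> x) (\<xi> y)) + b\<^sup>2 * Re (ip H (\<eta> x) (\<eta> y))
    + t * b / 2 * Re (\<phi> (inv\<^bsub>G\<^esub> y \<otimes>\<^bsub>G\<^esub> x) + \<phi> (inv\<^bsub>G\<^esub> x \<otimes>\<^bsub>G\<^esub> y))"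
    if "x \<in> carrier G" "y \<in> carrier G" for b x y
  proof -
    have "\<phi> (inv\<^bsub>G\<^esub> y \<otimes>\<^bsub>G\<^esub> x) = ip H (\<xi> x) (\<eta> y)" "\<phi> (inv\<^bsub>G\<^esub> x \<otimes>\<^bsub>G\<^esub> y) = cnj (ip H (\<eta> x) (\<xi> y))"
      using rep that c H.ip_cnj[of "\<eta> x" "\<xi> y"] by (auto simp: herz_schur_rep_def)
    then show ?thesis
      using that c by (simp add: v_def H.ip_add H.ip_add_right H.ip_smult H.ip_smult_right
          algebra_simps power2_eq_square)
  qed
  have t2: "t * (1 / (2 * t)) = 1 / 2" using t by simp
  define s where "s x y = Re (ip H (v (- 1 / (2 * t)) x) (v (- 1 / (2 * t)) y))" for x y
  show thesis
  proof (rule that)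
    show "psd_on (carrier G) s"
      unfolding s_def using v by (rule H.psd_on_gram)
    have "psd_on (carrier G) (\<lambda>x y. Re (ip H (v (1 / (2 * t)) x) (v (1 / (2 * t)) y)))"
      using v by (rule H.psd_on_gram)
    then show "psd_on (carrier G) (\<lambda>x y.
      Re (\<phi> (inv\<^bsub>G\<^esub> y \<otimes>\<^bsub>G\<^esub> x) + \<phi> (inv\<^bsub>G\<^esub> x \<otimes>\<^bsub>G\<^esub> y)) / 2 + s x y)"
      by (rule psd_on_cong) (use t in \<open>simp add: s_def gram power2_eq_square field_simps\<close>)
    fix x assume x: "x \<in> carrier G"
    \<comment> \<open>On the diagonal the mixed term is \<open>\<phi>\<close> at the identity, with
      a negative sign; this is what makes \<open>s\<close> small.\<close>
    have "s x x = t\<^sup>2 / 4 * (hnorm H (\<xi> x))\<^sup>2 + (hnorm H (\<eta> x))\<^sup>2 / (4 * t\<^sup>2) - Re (\<phi> \<one>\<^bsub>G\<^esub>) / 2"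
      using x c t by (simp add: s_def gram H.ip_self power2_eq_square field_simps)
    also have "\<dots> \<le> t\<^sup>2 / 4 * A\<^sup>2 + B\<^sup>2 / (4 * t\<^sup>2) - Re (\<phi> \<one>\<^bsub>G\<^esub>) / 2"
      using hA[OF x] hB[OF x] h0[OF x] t
      by (intro diff_right_mono add_mono mult_left_mono divide_right_mono power_mono) auto
    also have "t\<^sup>2 / 4 * A\<^sup>2 + B\<^sup>2 / (4 * t\<^sup>2) = (t\<^sup>2 * A\<^sup>2 + B\<^sup>2 / t\<^sup>2) / 4"
      by (simp add: field_simps)
    also have "\<dots> \<le> 2 * C / 4" using t(2) by (rule divide_right_mono) simp
    finally show "s x x \<le> (C - Re (\<phi> \<one>\<^bsub>G\<^esub>)) / 2" by (simp add: diff_divide_distrib)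
  qed
qed

section \<open>Approximate units from the Cowling-Haagerup constant\<close>

text \<open>The constant is an infimum that need not be attained, hence the slack
  \<open>\<delta>\<close> in the norm. Finiteness of \<open>F\<close> allows one index for all its
  points.\<close>

lemma cowling_haagerup_approx:
  assumes "weakly_amenable G" "cowling_haagerup G = 1" "finite F" "F \<subseteq> carrier G" "\<delta> > 0"
  obtains \<phi> where "finite {x \<in> carrier G. \<phi> x \<noteq> 0}" "\<And>x. x \<in> F \<Longrightarrow> cmod (\<phi> x - 1) < \<delta>"
    "\<phi> \<in> herz_schur G" "herz_schur_norm G \<phi> < 1 + \<delta>"
proof -
  have "Inf {C. weakly_amenable_with G C} < 1 + \<delta>"
    using assms by (simp add: cowling_haagerup_def)
  then obtain C where C: "weakly_amenable_with G C" "C < 1 + \<delta>"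
    using cInf_lessD[of "{C. weakly_amenable_with G C}"] assms(1) unfolding weakly_amenable_def
    by auto
  then obtain \<phi> where "(\<forall>n. finite {x \<in> carrier G. \<phi> n x \<noteq> 0}) \<and>
      (\<forall>x\<in>carrier G. (\<lambda>n::nat. \<phi> n x) \<longlonglongrightarrow> 1) \<and>
      (\<forall>n. \<phi> n \<in> herz_schur G \<and> herz_schur_norm G (\<phi> n) \<le> C)"
    unfolding weakly_amenable_with_def by (elim conjE exE) (rule that, intro conjI)
  then have \<phi>: "\<And>n. finite {x \<in> carrier G. \<phi> n x \<noteq> 0}"
    "\<And>x. x \<in> carrier G \<Longrightarrow> (\<lambda>n::nat. \<phi> n x) \<longlonglongrightarrow> 1"
    "\<And>n. \<phi> n \<in> herz_schur G" "\<And>n. herz_schur_norm G (\<phi> n) \<le> C"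
    by simp_all
  have "\<forall>\<^sub>F n in sequentially. dist (\<phi> n x) 1 < \<delta>" if "x \<in> F" for x
    using tendstoD[OF \<phi>(2)] that assms by blast
  then have "\<forall>\<^sub>F n in sequentially. \<forall>x\<in>F. dist (\<phi> n x) 1 < \<delta>"
    using assms(3) by (simp add: eventually_ball_finite)
  then obtain n where n: "\<forall>x\<in>F. dist (\<phi> n x) 1 < \<delta>"
    by (auto simp: eventually_sequentially)
  show thesis
    by (rule that[of "\<phi> n"]) (use \<phi>(1,3,4) C n in \<open>auto simp: dist_norm intro: le_less_trans\<close>)
qed

text \<open>The function \<open>p\<close> is the symmetrised real part of a multiplier
  \<open>\<phi>\<close>. The bound on \<open>s\<close> is half the gap between
  \<open>1 + \<delta>\<close> and the real part of \<open>\<phi>\<close> at the identity, which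
  exceeds \<open>1 - \<delta>\<close>.\<close>

lemma approx_kernel:
  fixes G :: "('a, 'b) monoid_scheme"
  assumes G: "group G" and wa: "weakly_amenable G" "cowling_haagerup G = 1"
    and F: "finite F" "F \<subseteq> carrier G" and \<delta>: "\<delta> > 0"
  shows "\<exists>p s. finite {x \<in> carrier G. p x \<noteq> 0} \<and> (\<forall>x\<in>insert \<one>\<^bsub>G\<^esub> F. \<bar>p x - 1\<bar> < \<delta>) \<and>
    psd_on (carrier G) s \<and> psd_on (carrier G) (\<lambda>x y. p (inv\<^bsub>G\<^esub> y \<otimes>\<^bsub>G\<^esub> x) + s x y) \<and>
    (\<forall>x\<in>carrier G. s x x \<le> \<delta>)"
proof -
  interpret G: group G by fact
  let ?F = "insert \<one>\<^bsub>G\<^esub> F"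
  \<comment> \<open>Since \<open>p\<close> averages \<open>\<phi>\<close> over a point and its
    inverse, both have to be controlled.\<close>
  have F': "finite (?F \<union> m_inv G ` ?F)" "?F \<union> m_inv G ` ?F \<subseteq> carrier G" using F by auto
  obtain \<phi> where \<phi>: "finite {x \<in> carrier G. \<phi> x \<noteq> 0}"
    "\<And>x. x \<in> ?F \<union> m_inv G ` ?F \<Longrightarrow> cmod (\<phi> x - 1) < \<delta>"
    "\<phi> \<in> herz_schur G" "herz_schur_norm G \<phi> < 1 + \<delta>"
    by (rule cowling_haagerup_approx[OF wa F' \<delta>]) (rule that)
  define p where "p x = Re (\<phi> x + \<phi> (inv\<^bsub>G\<^esub> x)) / 2" for x
  have re: "\<bar>Re (\<phi> x) - 1\<bar> < \<delta>" if "x \<in> ?F \<union> m_inv G ` ?F" for x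
    using \<phi>(2)[OF that] abs_Re_le_cmod[of "\<phi> x - 1"] by simp
  obtain s where s: "psd_on (carrier G) s"
    "psd_on (carrier G) (\<lambda>x y. Re (\<phi> (inv\<^bsub>G\<^esub> y \<otimes>\<^bsub>G\<^esub> x) + \<phi> (inv\<^bsub>G\<^esub> x \<otimes>\<^bsub>G\<^esub> y)) / 2 + s x y)"
    "\<And>x. x \<in> carrier G \<Longrightarrow> s x x \<le> (1 + \<delta> - Re (\<phi> \<one>\<^bsub>G\<^esub>)) / 2"
    using herz_schur_kernel[OF G \<phi>(3,4)] by blast
  have "finite {x \<in> carrier G. p x \<noteq> 0}"
  proof (rule finite_subset)
    show "{x \<in> carrier G. p x \<noteq> 0} \<subseteq>
      {x \<in> carrier G. \<phi> x \<noteq> 0} \<union> m_inv G ` {x \<in> carrier G. \<phi> x \<noteq> 0}"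
    proof
      fix x assume x: "x \<in> {x \<in> carrier G. p x \<noteq> 0}"
      then have "\<phi> x \<noteq> 0 \<or> \<phi> (inv\<^bsub>G\<^esub> x) \<noteq> 0" by (auto simp: p_def)
      then show "x \<in> {x \<in> carrier G. \<phi> x \<noteq> 0} \<union> m_inv G ` {x \<in> carrier G. \<phi> x \<noteq> 0}"
        using x by (auto intro!: image_eqI[of x _ "inv\<^bsub>G\<^esub> x"])
    qed
  qed (use \<phi>(1) in auto)
  moreover have "\<bar>p x - 1\<bar> < \<delta>" if "x \<in> ?F" for x
    using re[of x] re[of "inv\<^bsub>G\<^esub> x"] that by (auto simp: p_def abs_less_iff field_simps)
  moreover have "psd_on (carrier G) (\<lambda>x y. p (inv\<^bsub>G\<^esub> y \<otimes>\<^bsub>G\<^esub> x) + s x y)"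
    by (rule psd_on_cong[OF s(2)]) (simp add: p_def G.inv_mult_group)
  moreover have "s x x \<le> \<delta>" if "x \<in> carrier G" for x
    using s(3)[OF that] re[of "\<one>\<^bsub>G\<^esub>"] by auto
  ultimately show ?thesis using s(1) by blast
qed

section \<open>Summation of the approximating kernels\<close>

lemma sums_quadratic_form:
  fixes k :: "nat \<Rightarrow> 'a \<Rightarrow> 'a \<Rightarrow> real"
  assumes "\<And>x y. x \<in> A \<Longrightarrow> y \<in> A \<Longrightarrow> (\<lambda>n. k n x y) sums K x y"
  shows "(\<lambda>n. \<Sum>x\<in>A. \<Sum>y\<in>A. f x * f y * k n x y) sums (\<Sum>x\<in>A. \<Sum>y\<in>A. f x * f y * K x y)"
  using assms by (intro sums_sum sums_mult)

text \<open>A term depending on at most one of the two variables carries the factor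
  \<open>sum f A = 0\<close>. Thus centring is invisible on functions of sum zero.\<close>

lemma quadratic_form_centre:
  fixes k :: "'a \<Rightarrow> 'a \<Rightarrow> real"
  assumes "sum f A = 0"
  shows "(\<Sum>x\<in>A. \<Sum>y\<in>A. f x * f y * (k x y - a x - b y + c)) = (\<Sum>x\<in>A. \<Sum>y\<in>A. f x * f y * k x y)"
proof -
  have "(\<Sum>x\<in>A. \<Sum>y\<in>A. f x * f y * a x) = sum f A * (\<Sum>x\<in>A. f x * a x)"
    unfolding sum_product by (subst sum.swap) (simp add: mult_ac)
  moreover have "(\<Sum>x\<in>A. \<Sum>y\<in>A. f x * f y * b y) = sum f A * (\<Sum>x\<in>A. f x * b x)"
    unfolding sum_product by (simp add: mult_ac)
  moreover have "(\<Sum>x\<in>A. \<Sum>y\<in>A. f x * f y * c) = sum f A * (\<Sum>x\<in>A. f x * c)"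
    unfolding sum_product by (simp add: mult_ac)
  ultimately show ?thesis
    using assms by (simp add: right_diff_distrib distrib_left sum.distrib sum_subtractf)
qed

lemma quadratic_form_le:
  fixes k :: "'a \<Rightarrow> 'a \<Rightarrow> real"
  assumes "\<And>x y. x \<in> A \<Longrightarrow> y \<in> A \<Longrightarrow> \<bar>k x y\<bar> \<le> M"
  shows "(\<Sum>x\<in>A. \<Sum>y\<in>A. f x * f y * k x y) \<le> M * (\<Sum>x\<in>A. \<bar>f x\<bar>)\<^sup>2"
proof -
  have "(\<Sum>x\<in>A. \<Sum>y\<in>A. f x * f y * k x y) \<le> (\<Sum>x\<in>A. \<Sum>y\<in>A. \<bar>f x\<bar> * \<bar>f y\<bar> * M)"
  proof (intro sum_mono)
    fix x y assume xy: "x \<in> A" "y \<in> A"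
    have "f x * f y * k x y \<le> \<bar>f x\<bar> * \<bar>f y\<bar> * \<bar>k x y\<bar>"
      by (metis abs_ge_self abs_mult)
    also have "\<dots> \<le> \<bar>f x\<bar> * \<bar>f y\<bar> * M"
      using assms[OF xy] by (intro mult_left_mono) auto
    finally show "f x * f y * k x y \<le> \<bar>f x\<bar> * \<bar>f y\<bar> * M" .
  qed
  also have "\<dots> = M * (\<Sum>x\<in>A. \<bar>f x\<bar>)\<^sup>2"
    by (simp only: power2_eq_square sum_product) (simp add: sum_distrib_left mult_ac)
  finally show ?thesis .
qed

text \<open>Centring at the identity makes the series converge: its diagonal sees only
  \<open>p n \<one> - p n x\<close> and the small \<open>s n\<close>. On functions of sum zero the
  centring disappears again, leaving an invariant form and a small perturbation.\<close>

lemma almost_invariant_proper_kernel: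
  fixes G :: "('a, 'b) monoid_scheme"
  assumes G: "group G" and cnt: "countable (carrier G)"
    and wa: "weakly_amenable G" "cowling_haagerup G = 1"
  obtains k :: "'a \<Rightarrow> 'a \<Rightarrow> real"
  where "psd_on (carrier G) k"
    and "\<And>A f s. finite A \<Longrightarrow> A \<subseteq> carrier G \<Longrightarrow> sum f A = 0 \<Longrightarrow> s \<in> carrier G \<Longrightarrow>
      (\<Sum>x\<in>A. \<Sum>y\<in>A. f x * f y * k (s \<otimes>\<^bsub>G\<^esub> x) (s \<otimes>\<^bsub>G\<^esub> y))
        \<le> (\<Sum>x\<in>A. \<Sum>y\<in>A. f x * f y * k x y) + (\<Sum>x\<in>A. \<bar>f x\<bar>)\<^sup>2"
    and "\<And>x. x \<in> carrier G \<Longrightarrow> k x \<one>\<^bsub>G\<^esub> = 0"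
    and "\<And>R. finite {x \<in> carrier G. k x x \<le> R}"
proof -
  interpret G: group G by fact
  let ?e = "\<one>\<^bsub>G\<^esub>" and ?X = "carrier G"
  \<comment> \<open>The weights add up to 1, the constant in front of the squared \<open>l1\<close>
    norm.\<close>
  define \<delta> :: "nat \<Rightarrow> real" where "\<delta> n = (1 / 2) ^ Suc n" for n
  have \<delta>_pos: "\<delta> n > 0" for n by (simp add: \<delta>_def)
  have \<delta>_sums: "\<delta> sums 1" unfolding \<delta>_def[abs_def] by (rule power_half_series)
  have ne: "?X \<noteq> {}" using G.one_closed by blast
  \<comment> \<open>Stage \<open>n\<close> controls the values at \<open>0\<close> to
    \<open>n\<close> of an enumeration, so each group element is controlled from some stage
    on.\<close>
  define approx where "approx n p s \<longleftrightarrow> finite {x \<in> ?X. p x \<noteq> 0} \<and>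
    (\<forall>x\<in>insert ?e (from_nat_into ?X ` {..n}). \<bar>p x - 1\<bar> < \<delta> n) \<and>
    psd_on ?X s \<and> psd_on ?X (\<lambda>x y. p (inv\<^bsub>G\<^esub> y \<otimes>\<^bsub>G\<^esub> x) + s x y) \<and> (\<forall>x\<in>?X. s x x \<le> \<delta> n)"
    for n p s
  have "\<forall>n. \<exists>p s. approx n p s"
    unfolding approx_def using from_nat_into[OF ne] by (intro allI approx_kernel[OF G wa] \<delta>_pos) auto
  then obtain p s where "\<And>n. approx n (p n) (s n)" by metis
  then have approx: "finite {x \<in> ?X. p n x \<noteq> 0} \<and>
    (\<forall>x\<in>insert ?e (from_nat_into ?X ` {..n}). \<bar>p n x - 1\<bar> < \<delta> n) \<and>
    psd_on ?X (s n) \<and> psd_on ?X (\<lambda>x y. p n (inv\<^bsub>G\<^esub> y \<otimes>\<^bsub>G\<^esub> x) + s n x y) \<and>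
    (\<forall>x\<in>?X. s n x x \<le> \<delta> n)" for n
    unfolding approx_def .
  then have
    fin: "\<And>n. finite {x \<in> ?X. p n x \<noteq> 0}" and
    near: "\<And>n x. x \<in> insert ?e (from_nat_into ?X ` {..n}) \<Longrightarrow> \<bar>p n x - 1\<bar> < \<delta> n" and
    s: "\<And>n. psd_on ?X (s n)" and
    r: "\<And>n. psd_on ?X (\<lambda>x y. p n (inv\<^bsub>G\<^esub> y \<otimes>\<^bsub>G\<^esub> x) + s n x y)" and
    sd: "\<And>n x. x \<in> ?X \<Longrightarrow> s n x x \<le> \<delta> n"
    by blast+
  define r' where "r' n x y = p n (inv\<^bsub>G\<^esub> y \<otimes>\<^bsub>G\<^esub> x) + s n x y" for n x y
  define k' where "k' n x y = r' n x y - r' n x ?e - r' n ?e y + r' n ?e ?e" for n x y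
  define k where "k x y = (\<Sum>n. k' n x y)" for x y
  have r': "psd_on ?X (r' n)" for n using r[of n] by (simp add: r'_def[abs_def])
  have k': "psd_on ?X (k' n)" for n
    using psd_on_centre[OF r', of ?e n] by (simp add: k'_def[abs_def])
  have s_abs: "\<bar>s n x y\<bar> \<le> \<delta> n" if "x \<in> ?X" "y \<in> ?X" for n x y
    using psd_on_abs_le[OF s[of n] that] sd[OF that(1), of n] sd[OF that(2), of n] by linarith
  have k'_diag: "k' n x x = 2 * (p n ?e - p n x) + (s n x x - s n x ?e - s n ?e x + s n ?e ?e)"
    if x: "x \<in> ?X" for n x
  proof -
    have "r' n ?e x = r' n x ?e" using psd_on_sym[OF r', of ?e x n] x by simp
    moreover have "s n ?e x = s n x ?e" using psd_on_sym[OF s, of ?e x n] x by simp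
    ultimately show ?thesis using x by (simp add: k'_def) (simp add: r'_def)
  qed
  \<comment> \<open>The \<open>s\<close> terms form the diagonal of a centred kernel and are
    therefore nonnegative.\<close>
  have k'_ge: "k' n x x \<ge> 2 * (p n ?e - p n x)" if x: "x \<in> ?X" for n x
    using psd_on_diag[OF psd_on_centre[OF s[of n] G.one_closed] x] k'_diag[OF x, of n] by simp
  have diag_summable: "summable (\<lambda>n. k' n x x)" if x: "x \<in> ?X" for x
  proof (rule summable_comparison_test)
    obtain m where m: "x = from_nat_into ?X m"
      using from_nat_into_surj[OF cnt x] by metis
    \<comment> \<open>Twice the difference of two numbers within \<open>\<delta> n\<close> of 1
      contributes 4, the four entries of \<open>s n\<close> another 4.\<close>
    show "\<exists>N. \<forall>n\<ge>N. norm (k' n x x) \<le> 8 * \<delta> n"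
    proof (intro exI allI impI)
      fix n assume "n \<ge> m"
      then have "\<bar>p n x - 1\<bar> < \<delta> n" using m by (intro near) auto
      moreover have "\<bar>p n ?e - 1\<bar> < \<delta> n" by (intro near) auto
      ultimately have "k' n x x \<le> 8 * \<delta> n"
        using k'_diag[OF x, of n, unfolded right_diff_distrib] s_abs[OF x x, of n] s_abs[OF x G.one_closed, of n]
          s_abs[OF G.one_closed x, of n] s_abs[OF G.one_closed G.one_closed, of n]
        unfolding abs_le_iff abs_less_iff by (elim conjE) linarith
      then show "norm (k' n x x) \<le> 8 * \<delta> n" using psd_on_diag[OF k' x, of n] by simp
    qed
    show "summable (\<lambda>n. 8 * \<delta> n)"
      by (intro summable_mult sums_summable[OF \<delta>_sums])
  qed
  have sums: "(\<lambda>n. k' n x y) sums k x y" if xy: "x \<in> ?X" "y \<in> ?X" for x y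
  proof -
    have "summable (\<lambda>n. k' n x y)"
    proof (rule summable_comparison_test)
      \<comment> \<open>Diagonal entries dominate off-diagonal ones, which reduces convergence to
        the diagonal.\<close>
      show "\<exists>N. \<forall>n\<ge>N. norm (k' n x y) \<le> k' n x x + k' n y y"
        using order_trans[OF _ psd_on_abs_le[OF k' xy]] by simp
      show "summable (\<lambda>n. k' n x x + k' n y y)"
        using xy diag_summable by (intro summable_add)
    qed
    then show ?thesis unfolding k_def by (rule summable_sums)
  qed
  show thesis
  proof (rule that)
    show "psd_on ?X k"
    proof (rule psd_onI)
      show "k x y = k y x" if "x \<in> ?X" "y \<in> ?X" for x y
        using psd_on_sym[OF k' that] by (simp add: k_def)
      fix A and f :: "'a \<Rightarrow> real" assume A: "finite A" "A \<subseteq> ?X"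
      have "(\<lambda>n. \<Sum>x\<in>A. \<Sum>y\<in>A. f x * f y * k' n x y) sums (\<Sum>x\<in>A. \<Sum>y\<in>A. f x * f y * k x y)"
        using A sums by (intro sums_quadratic_form) auto
      then show "0 \<le> (\<Sum>x\<in>A. \<Sum>y\<in>A. f x * f y * k x y)"
        by (rule sums_le[OF _ sums_zero, rotated]) (rule psd_on_nonneg[OF k' A])
    qed
  next
    fix A t and f :: "'a \<Rightarrow> real"
    assume A: "finite A" "A \<subseteq> ?X" and f: "sum f A = 0" and t: "t \<in> ?X"
    have cl: "x \<in> ?X" "t \<otimes>\<^bsub>G\<^esub> x \<in> ?X" if "x \<in> A" for x using that A t by auto
    let ?N = "(\<Sum>x\<in>A. \<bar>f x\<bar>)\<^sup>2"
    define P where "P n = (\<Sum>x\<in>A. \<Sum>y\<in>A. f x * f y * p n (inv\<^bsub>G\<^esub> y \<otimes>\<^bsub>G\<^esub> x))" for n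
    have le: "(\<Sum>x\<in>A. \<Sum>y\<in>A. f x * f y * k' n (t \<otimes>\<^bsub>G\<^esub> x) (t \<otimes>\<^bsub>G\<^esub> y))
      \<le> (\<Sum>x\<in>A. \<Sum>y\<in>A. f x * f y * k' n x y) + \<delta> n * ?N" for n
    proof -
      have "(\<Sum>x\<in>A. \<Sum>y\<in>A. f x * f y * k' n (t \<otimes>\<^bsub>G\<^esub> x) (t \<otimes>\<^bsub>G\<^esub> y))
        = (\<Sum>x\<in>A. \<Sum>y\<in>A. f x * f y * r' n (t \<otimes>\<^bsub>G\<^esub> x) (t \<otimes>\<^bsub>G\<^esub> y))"
        unfolding k'_def by (rule quadratic_form_centre[OF f])
      also have "\<dots> = (\<Sum>x\<in>A. \<Sum>y\<in>A. f x * f y * p n (inv\<^bsub>G\<^esub> y \<otimes>\<^bsub>G\<^esub> x)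
          + f x * f y * s n (t \<otimes>\<^bsub>G\<^esub> x) (t \<otimes>\<^bsub>G\<^esub> y))"
      proof (intro sum.cong refl)
        fix x y assume "x \<in> A" "y \<in> A"
        then have xy: "x \<in> ?X" "y \<in> ?X" using A by auto
        \<comment> \<open>The translation cancels, so the \<open>p\<close> part is exactly invariant
          and only the \<open>s\<close> part changes.\<close>
        have "inv\<^bsub>G\<^esub> (t \<otimes>\<^bsub>G\<^esub> y) \<otimes>\<^bsub>G\<^esub> (t \<otimes>\<^bsub>G\<^esub> x) = inv\<^bsub>G\<^esub> y \<otimes>\<^bsub>G\<^esub> x"
          using xy t by (simp add: G.inv_mult_group G.m_assoc G.inv_solve_left')
        then show "f x * f y * r' n (t \<otimes>\<^bsub>G\<^esub> x) (t \<otimes>\<^bsub>G\<^esub> y) = f x * f y * p n (inv\<^bsub>G\<^esub> y \<otimes>\<^bsub>G\<^esub> x)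
          + f x * f y * s n (t \<otimes>\<^bsub>G\<^esub> x) (t \<otimes>\<^bsub>G\<^esub> y)"
          by (simp add: r'_def distrib_left)
      qed
      also have "\<dots> \<le> P n + \<delta> n * ?N"
        unfolding P_def sum.distrib using cl s_abs by (intro add_left_mono quadratic_form_le) auto
      \<comment> \<open>The untranslated \<open>s\<close> form is nonnegative, so it can be added
        back to recover \<open>r'\<close>.\<close>
      also have "P n \<le> P n + (\<Sum>x\<in>A. \<Sum>y\<in>A. f x * f y * s n x y)"
        using psd_on_nonneg[OF s A] by simp
      also have "\<dots> = (\<Sum>x\<in>A. \<Sum>y\<in>A. f x * f y * r' n x y)"
        unfolding P_def r'_def by (simp add: distrib_left sum.distrib)
      also have "\<dots> = (\<Sum>x\<in>A. \<Sum>y\<in>A. f x * f y * k' n x y)"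
        unfolding k'_def by (rule quadratic_form_centre[OF f, symmetric])
      finally show ?thesis by simp
    qed
    have lhs: "(\<lambda>n. \<Sum>x\<in>A. \<Sum>y\<in>A. f x * f y * k' n (t \<otimes>\<^bsub>G\<^esub> x) (t \<otimes>\<^bsub>G\<^esub> y)) sums
        (\<Sum>x\<in>A. \<Sum>y\<in>A. f x * f y * k (t \<otimes>\<^bsub>G\<^esub> x) (t \<otimes>\<^bsub>G\<^esub> y))"
      using cl sums by (intro sums_quadratic_form) auto
    have "(\<lambda>n. \<delta> n * ?N) sums (1 * ?N)"
      by (intro sums_mult2 \<delta>_sums)
    then have "(\<lambda>n. (\<Sum>x\<in>A. \<Sum>y\<in>A. f x * f y * k' n x y) + \<delta> n * ?N) sums
        ((\<Sum>x\<in>A. \<Sum>y\<in>A. f x * f y * k x y) + 1 * ?N)"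
      using cl sums by (intro sums_add sums_quadratic_form) auto
    then show "(\<Sum>x\<in>A. \<Sum>y\<in>A. f x * f y * k (t \<otimes>\<^bsub>G\<^esub> x) (t \<otimes>\<^bsub>G\<^esub> y))
        \<le> (\<Sum>x\<in>A. \<Sum>y\<in>A. f x * f y * k x y) + ?N"
      unfolding mult_1 by (rule sums_le[OF le lhs])
  next
    show "k x ?e = 0" if "x \<in> ?X" for x by (simp add: k_def k'_def)
  next
    fix R
    obtain N :: nat where N: "real N > R" using reals_Archimedean2 by blast
    show "finite {x \<in> ?X. k x x \<le> R}"
    proof (rule finite_subset)
      \<comment> \<open>Outside the first \<open>N\<close> supports, each of the first
        \<open>N\<close> summands of \<open>k x x\<close> is at least 1, which forces
        \<open>k x x \<ge> N > R\<close>.\<close>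
      show "{x \<in> ?X. k x x \<le> R} \<subseteq> (\<Union>n<N. {x \<in> ?X. p n x \<noteq> 0})"
      proof (rule ccontr)
        assume "\<not> ?thesis"
        then obtain x where x: "x \<in> ?X" "k x x \<le> R" "\<And>n. n < N \<Longrightarrow> p n x = 0" by auto
        have "real N = (\<Sum>n<N. 1)" by simp
        also have "\<dots> \<le> (\<Sum>n<N. k' n x x)"
        proof (rule sum_mono)
          fix n assume n: "n \<in> {..<N}"
          have "\<delta> n \<le> 1 / 2" using power_le_one[of "1 / 2 :: real" n] by (simp add: \<delta>_def)
          then have "p n ?e \<ge> 1 / 2" using near[of ?e n] by auto
          then show "1 \<le> k' n x x" using k'_ge[OF x(1), of n] x(3)[of n] n by simp
        qed
        also have "\<dots> \<le> k x x"
          unfolding k_def using diag_summable[OF x(1)] psd_on_diag[OF k' x(1)]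
          by (intro sum_le_suminf) auto
        finally show False using x N by simp
      qed
    qed (use fin in auto)
  qed
qed


section \<open>Gaussian variables\<close>

abbreviation std_gaussian :: "real measure" where
  "std_gaussian \<equiv> density lborel std_normal_density"

abbreviation gaussian_sequence :: "(nat \<Rightarrow> real) measure" where
  "gaussian_sequence \<equiv> Pi\<^sub>M UNIV (\<lambda>_. std_gaussian)"

lemma sets_gaussian_sequence: "sets gaussian_sequence = sets (Pi\<^sub>M UNIV (\<lambda>_. borel))"
  by (intro sets_PiM_cong) auto

text \<open>A combination of independent standard Gaussians is normal with variance the sum of the
  squared coefficients; the first absolute moment is the standard deviation times
  \<open>sqrt (2 / pi)\<close>.\<close>

lemma nn_integral_abs_gaussian_combination:
  "(\<integral>\<^sup>+\<omega>. ennreal \<bar>\<Sum>j<N. c j * \<omega> j\<bar> \<partial>gaussian_sequence)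
    = ennreal (sqrt (2 / pi) * sqrt (\<Sum>j<N. (c j)\<^sup>2))"
proof -
  note sets_gaussian_sequence [measurable_cong]
  interpret S: prob_space std_gaussian by (rule prob_space_normal_density) simp
  interpret prob_space gaussian_sequence by (rule prob_space_PiM) (rule S.prob_space_axioms)
  \<comment> \<open>A normal density requires a positive standard deviation, so zero coefficients
    are discarded. If none remains, both sides are 0.\<close>
  define I where "I = {j. j < N \<and> c j \<noteq> 0}"
  have I: "finite I" by (simp add: I_def)
  have comb: "(\<Sum>j<N. c j * \<omega> j) = (\<Sum>j\<in>I. c j * \<omega> j)" for \<omega>
    unfolding I_def by (rule sum.mono_neutral_right) auto
  have var: "(\<Sum>j<N. (c j)\<^sup>2) = (\<Sum>j\<in>I. (c j)\<^sup>2)"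
    unfolding I_def by (rule sum.mono_neutral_right) auto
  show ?thesis
  proof (cases "I = {}")
    case True
    then show ?thesis unfolding comb var by simp
  next
    case False
    have coord: "distr gaussian_sequence borel (\<lambda>\<omega>. \<omega> j) = std_gaussian" for j
    proof -
      have "distr gaussian_sequence borel (\<lambda>\<omega>. \<omega> j) = distr gaussian_sequence std_gaussian (\<lambda>\<omega>. \<omega> j)"
        by (intro distr_cong) auto
      then show ?thesis
        using distr_PiM_component[of UNIV "\<lambda>_. std_gaussian" j] S.prob_space_axioms by simp
    qed
    have meas: "(\<lambda>\<omega>. \<omega> j) \<in> gaussian_sequence \<rightarrow>\<^sub>M borel" for j
      by measurable
    \<comment> \<open>Independence amounts to the joint law being the product of the coordinate
      laws, and here that is a projection of the infinite product.\<close>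
    have "indep_vars (\<lambda>_. borel) (\<lambda>j \<omega>. \<omega> j) I"
    proof (subst indep_vars_iff_distr_eq_PiM'[OF False])
      show "random_variable borel (\<lambda>\<omega>. \<omega> j)" for j by (rule meas)
      have "distr gaussian_sequence (Pi\<^sub>M I (\<lambda>_. borel)) (\<lambda>x. \<lambda>i\<in>I. x i) =
          distr gaussian_sequence (Pi\<^sub>M I (\<lambda>_. std_gaussian)) (\<lambda>x. \<lambda>i\<in>I. x i)"
        by (intro distr_cong refl sets_PiM_cong) auto
      also have "\<dots> = Pi\<^sub>M I (\<lambda>_. std_gaussian)"
        using distr_PiM_reindex[of UNIV "\<lambda>_. std_gaussian" "\<lambda>j. j" I] S.prob_space_axioms by simp
      finally show "distr gaussian_sequence (Pi\<^sub>M I (\<lambda>_. borel)) (\<lambda>x. \<lambda>i\<in>I. x i) =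
          Pi\<^sub>M I (\<lambda>i. distr gaussian_sequence borel (\<lambda>\<omega>. \<omega> i))"
        by (simp add: coord)
    qed
    then have indep: "indep_vars (\<lambda>_. borel) (\<lambda>j \<omega>. c j * \<omega> j) I"
      by (rule indep_vars_compose2) auto
    have std: "distributed gaussian_sequence lborel (\<lambda>\<omega>. \<omega> j) std_normal_density" for j
      unfolding distributed_def using meas[of j] coord[of j]
      by (simp cong: distr_cong)
    have normal: "distributed gaussian_sequence lborel (\<lambda>\<omega>. c j * \<omega> j) (normal_density 0 \<bar>c j\<bar>)"
      if "j \<in> I" for j
      using normal_density_affine[OF std[of j], of "c j" 0] that by (simp add: I_def)
    define v where "v = sqrt (\<Sum>j\<in>I. (c j)\<^sup>2)"
    have "(\<Sum>j\<in>I. (c j)\<^sup>2) > 0"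
      using I False by (intro sum_pos) (auto simp: I_def)
    then have v: "v > 0" by (simp add: v_def)
    have "distributed gaussian_sequence lborel (\<lambda>\<omega>. \<Sum>j\<in>I. c j * \<omega> j)
        (normal_density (\<Sum>j\<in>I. 0) (sqrt (\<Sum>j\<in>I. \<bar>c j\<bar>\<^sup>2)))"
      using normal by (intro sum_indep_normal[OF I False indep]) (auto simp: I_def)
    then have "distributed gaussian_sequence lborel (\<lambda>\<omega>. \<Sum>j\<in>I. c j * \<omega> j) (normal_density 0 v)"
      by (simp add: v_def)
    from distributed_nn_integral[OF this, of "\<lambda>x. ennreal \<bar>x\<bar>"]
    have "(\<integral>\<^sup>+\<omega>. ennreal \<bar>\<Sum>j\<in>I. c j * \<omega> j\<bar> \<partial>gaussian_sequence)
        = (\<integral>\<^sup>+x. ennreal (normal_density 0 v x * \<bar>x\<bar>) \<partial>lborel)"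
      by (simp add: ennreal_mult')
    also have "\<dots> = ennreal (v * sqrt (2 / pi))"
    proof -
      \<comment> \<open>The odd absolute moment of order \<open>2 * 0 + 1\<close>.\<close>
      have "has_bochner_integral lborel (\<lambda>x. normal_density 0 v x * \<bar>x\<bar>) (v * sqrt (2 / pi))"
        using normal_moment_abs_odd[OF v, of 0 0] by (simp add: mult_ac)
      then show ?thesis
        by (subst nn_integral_eq_integral) (auto simp: has_bochner_integral_iff)
    qed
    finally show ?thesis unfolding comb var v_def by (simp only: mult.commute)
  qed
qed

text \<open>Each \<open>V x\<close> joins a Gaussian variable to the indicator of a private atom.
  The two parts have disjoint supports, so their norms add. The Gaussians have covariance
  \<open>k\<close> by the Cholesky factorisation.\<close>

lemma l1_model_of_psd_kernel:
  fixes k :: "'a \<Rightarrow> 'a \<Rightarrow> real"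
  assumes k: "psd_on X k" and X: "countable X" "X \<noteq> {}"
  obtains \<mu> :: "(nat \<Rightarrow> real) measure" and V :: "'a \<Rightarrow> (nat \<Rightarrow> real) \<Rightarrow> real"
  where "\<And>x. x \<in> X \<Longrightarrow> integrable \<mu> (V x)"
    and "\<And>A f. finite A \<Longrightarrow> A \<subseteq> X \<Longrightarrow> (\<integral>\<omega>. \<bar>\<Sum>x\<in>A. f x * V x \<omega>\<bar> \<partial>\<mu>) =
      sqrt (2 / pi) * sqrt (\<Sum>x\<in>A. \<Sum>y\<in>A. f x * f y * k x y) + (\<Sum>x\<in>A. \<bar>f x\<bar>)"
proof -
  note sets_gaussian_sequence [measurable_cong]
  interpret S: prob_space std_gaussian by (rule prob_space_normal_density) simp
  interpret P: prob_space gaussian_sequence by (rule prob_space_PiM) (rule S.prob_space_axioms)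
  define idx where "idx = to_nat_on X"
  have inj: "inj_on idx X" unfolding idx_def using X(1) by (rule inj_on_to_nat_on)
  have "psd_on UNIV (\<lambda>m n. k (from_nat_into X m) (from_nat_into X n))"
    using from_nat_into[OF X(2)] by (intro psd_on_map[OF k]) auto
  then obtain a where a: "\<And>m n N. m < N \<Longrightarrow> k (from_nat_into X m) (from_nat_into X n) = (\<Sum>j<N. a m j * a n j)"
    and a0: "\<And>m j. m < j \<Longrightarrow> a m j = (0::real)"
    by (rule psd_on_nat_cholesky) blast
  \<comment> \<open>Coordinate 0 is a label: 0 for the Gaussian part, \<open>n + 1\<close> for the \<open>n\<close>-th atom.\<close>
  define \<mu> :: "(nat \<Rightarrow> real) measure" where
    "\<mu> = distr (count_space UNIV \<Otimes>\<^sub>M gaussian_sequence) (Pi\<^sub>M UNIV (\<lambda>_. borel))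
      (\<lambda>(i, \<omega>). case_nat (real i) \<omega>)"
  \<comment> \<open>Triangularity lets \<open>j \<le> idx x\<close> cover the whole row;
    \<open>Suc j\<close> skips the label coordinate.\<close>
  define V where "V x \<omega> = (if \<omega> 0 = 0 then \<Sum>j\<le>idx x. a (idx x) j * \<omega> (Suc j)
    else indicator {real (Suc (idx x))} (\<omega> 0))" for x and \<omega> :: "nat \<Rightarrow> real"
  have label: "(\<lambda>(i, \<omega>). case_nat (real i) \<omega>) \<in>
      count_space UNIV \<Otimes>\<^sub>M gaussian_sequence \<rightarrow>\<^sub>M Pi\<^sub>M UNIV (\<lambda>_. borel)"
  proof (rule measurable_PiM_single')
    show "(\<lambda>p. (case p of (i, \<omega>) \<Rightarrow> case_nat (real i) \<omega>) n) \<in>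
        borel_measurable (count_space UNIV \<Otimes>\<^sub>M gaussian_sequence)" for n
      by (cases n) (simp_all add: split_beta')
  qed auto
  have V_meas [measurable]: "V x \<in> borel_measurable (Pi\<^sub>M UNIV (\<lambda>_. borel))" for x
    unfolding V_def by measurable
  have sets_\<mu>: "sets \<mu> = sets (Pi\<^sub>M UNIV (\<lambda>_. borel))" by (simp add: \<mu>_def)
  note sets_\<mu> [measurable_cong]
  have nn: "(\<integral>\<^sup>+\<omega>. ennreal \<bar>\<Sum>x\<in>A. f x * V x \<omega>\<bar> \<partial>\<mu>) =
      ennreal (sqrt (2 / pi) * sqrt (\<Sum>x\<in>A. \<Sum>y\<in>A. f x * f y * k x y) + (\<Sum>x\<in>A. \<bar>f x\<bar>))"
    if A: "finite A" "A \<subseteq> X" for A f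
  proof -
    \<comment> \<open>A strict upper bound for the indices in \<open>A\<close>; the inserted 0
      handles empty \<open>A\<close>.\<close>
    define N where "N = Suc (Max (insert 0 (idx ` A)))"
    have N: "idx x < N" if "x \<in> A" for x
      using A that by (simp add: N_def less_Suc_eq_le)
    define c where "c j = (\<Sum>x\<in>A. f x * a (idx x) j)" for j
    define F where "F i \<omega> = \<bar>\<Sum>x\<in>A. f x * V x (case_nat (real i) \<omega>)\<bar>" for i :: nat and \<omega>
    have le: "i \<le> m" if "a m i \<noteq> 0" for m i
      using a0[of m i] that by force
    have "(\<Sum>x\<in>A. f x * V x (case_nat 0 \<omega>)) = (\<Sum>j<N. c j * \<omega> j)" for \<omega>
    proof -
      have "V x (case_nat 0 \<omega>) = (\<Sum>j<N. a (idx x) j * \<omega> j)" if "x \<in> A" for x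
        unfolding V_def using N[OF that] le by (auto intro!: sum.mono_neutral_left)
      then have "(\<Sum>x\<in>A. f x * V x (case_nat 0 \<omega>)) = (\<Sum>x\<in>A. \<Sum>j<N. f x * a (idx x) j * \<omega> j)"
        by (simp add: sum_distrib_left mult.assoc)
      also have "\<dots> = (\<Sum>j<N. c j * \<omega> j)"
        unfolding c_def sum_distrib_right by (rule sum.swap)
      finally show ?thesis .
    qed
    then have "(\<integral>\<^sup>+\<omega>. ennreal (F 0 \<omega>) \<partial>gaussian_sequence) = ennreal (sqrt (2 / pi) * sqrt (\<Sum>j<N. (c j)\<^sup>2))"
      by (simp add: F_def nn_integral_abs_gaussian_combination)
    also have "(\<Sum>j<N. (c j)\<^sup>2) = (\<Sum>j<N. \<Sum>x\<in>A. \<Sum>y\<in>A. f x * f y * (a (idx x) j * a (idx y) j))"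
      by (simp add: c_def power2_eq_square sum_product mult_ac)
    also have "\<dots> = (\<Sum>x\<in>A. \<Sum>j<N. \<Sum>y\<in>A. f x * f y * (a (idx x) j * a (idx y) j))"
      by (rule sum.swap)
    also have "\<dots> = (\<Sum>x\<in>A. \<Sum>y\<in>A. \<Sum>j<N. f x * f y * (a (idx x) j * a (idx y) j))"
      by (intro sum.cong refl sum.swap)
    also have "\<dots> = (\<Sum>x\<in>A. \<Sum>y\<in>A. f x * f y * k x y)"
    proof (intro sum.cong refl)
      fix x y assume xy: "x \<in> A" "y \<in> A"
      have "k x y = (\<Sum>j<N. a (idx x) j * a (idx y) j)"
        using a[OF N[OF xy(1)], of "idx y"] X(1) A xy by (simp add: idx_def subset_iff)
      then show "(\<Sum>j<N. f x * f y * (a (idx x) j * a (idx y) j)) = f x * f y * k x y"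
        by (simp add: sum_distrib_left)
    qed
    finally have F0: "(\<integral>\<^sup>+\<omega>. ennreal (F 0 \<omega>) \<partial>gaussian_sequence) =
      ennreal (sqrt (2 / pi) * sqrt (\<Sum>x\<in>A. \<Sum>y\<in>A. f x * f y * k x y))" .
    \<comment> \<open>On a slice with positive label the functions are constant, and the slice has
      mass 1, so it acts as one atom.\<close>
    have FSuc: "F (Suc m) \<omega> = \<bar>\<Sum>x\<in>A. if idx x = m then f x else 0\<bar>" for m \<omega>
    proof -
      have "V x (case_nat (real (Suc m)) \<omega>) = (if idx x = m then 1 else 0)" for x
        by (auto simp: V_def indicator_def)
      then show ?thesis unfolding F_def by (intro arg_cong[where f=abs] sum.cong) auto
    qed
    \<comment> \<open>Only finitely many atoms contribute, and injectivity of \<open>idx\<close>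
      leaves one coefficient on each of them.\<close>
    have "(\<Sum>m. ennreal \<bar>\<Sum>x\<in>A. if idx x = m then f x else 0\<bar>) =
        (\<Sum>m\<in>idx ` A. ennreal \<bar>\<Sum>x\<in>A. if idx x = m then f x else 0\<bar>)"
      using A by (intro suminf_finite) (auto intro!: sum.neutral)
    also have "\<dots> = (\<Sum>y\<in>A. ennreal \<bar>\<Sum>x\<in>A. if idx x = idx y then f x else 0\<bar>)"
      using inj_on_subset[OF inj A(2)] by (simp add: sum.reindex)
    also have "\<dots> = (\<Sum>y\<in>A. ennreal \<bar>f y\<bar>)"
    proof (intro sum.cong refl)
      fix y assume y: "y \<in> A"
      have "(\<Sum>x\<in>A. if idx x = idx y then f x else 0) = (\<Sum>x\<in>A. if x = y then f x else 0)"
        using inj_on_subset[OF inj A(2)] y by (intro sum.cong) (auto simp: inj_on_def)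
      then show "ennreal \<bar>\<Sum>x\<in>A. if idx x = idx y then f x else 0\<bar> = ennreal \<bar>f y\<bar>"
        using A y by simp
    qed
    finally have l1: "(\<Sum>m. ennreal \<bar>\<Sum>x\<in>A. if idx x = m then f x else 0\<bar>) = ennreal (\<Sum>y\<in>A. \<bar>f y\<bar>)"
      by (simp add: sum_ennreal)
    have meas: "(\<lambda>p. ennreal (F (fst p) (snd p))) \<in> borel_measurable (count_space UNIV \<Otimes>\<^sub>M gaussian_sequence)"
      using measurable_compose[OF label, of "\<lambda>\<omega>. ennreal \<bar>\<Sum>x\<in>A. f x * V x \<omega>\<bar>" borel]
      by (simp add: F_def split_beta')
    have "(\<integral>\<^sup>+\<omega>. ennreal \<bar>\<Sum>x\<in>A. f x * V x \<omega>\<bar> \<partial>\<mu>) =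
        (\<integral>\<^sup>+p. ennreal (F (fst p) (snd p)) \<partial>(count_space UNIV \<Otimes>\<^sub>M gaussian_sequence))"
      unfolding \<mu>_def by (subst nn_integral_distr[OF label]) (auto simp: F_def split_beta')
    \<comment> \<open>Tonelli over the label, where counting measure turns the outer integral into a
      series.\<close>
    also have "\<dots> = (\<Sum>i. \<integral>\<^sup>+\<omega>. ennreal (F i \<omega>) \<partial>gaussian_sequence)"
      using P.nn_integral_fst[OF meas] by (simp add: nn_integral_count_space_nat)
    also have "\<dots> = (\<integral>\<^sup>+\<omega>. ennreal (F 0 \<omega>) \<partial>gaussian_sequence) +
        (\<Sum>m. \<integral>\<^sup>+\<omega>. ennreal (F (Suc m) \<omega>) \<partial>gaussian_sequence)"
      by (subst suminf_offset[where i = 1]) (auto simp: add.commute)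
    also have "(\<Sum>m. \<integral>\<^sup>+\<omega>. ennreal (F (Suc m) \<omega>) \<partial>gaussian_sequence) = ennreal (\<Sum>y\<in>A. \<bar>f y\<bar>)"
      by (simp add: FSuc P.emeasure_space_1 l1)
    finally show ?thesis
      using psd_on_nonneg[OF k A, of f] by (simp add: F0 sum_nonneg)
  qed
  show thesis
  proof (rule that)
    show "integrable \<mu> (V x)" if "x \<in> X" for x
      using nn[of "{x}" "\<lambda>_. 1"] that by (intro integrableI_bounded) auto
    show "(\<integral>\<omega>. \<bar>\<Sum>x\<in>A. f x * V x \<omega>\<bar> \<partial>\<mu>) =
      sqrt (2 / pi) * sqrt (\<Sum>x\<in>A. \<Sum>y\<in>A. f x * f y * k x y) + (\<Sum>x\<in>A. \<bar>f x\<bar>)"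
      if "finite A" "A \<subseteq> X" for A f
      using psd_on_nonneg[OF k that, of f]
      by (subst integral_eq_nn_integral) (auto simp: nn[OF that] sum_nonneg simp del: ennreal_plus)
  qed
qed


section \<open>Extension of affine actions to the closure\<close>

text \<open>Completeness is phrased through summable increments: this is what the Riesz-Fischer
  argument yields directly, and approximants with geometric errors satisfy it.\<close>

locale banach_module = module scalars N for N :: "('v, 'm) normed_scheme" (structure) +
  assumes vnorm_add: "\<lbrakk>x \<in> carrier N; y \<in> carrier N\<rbrakk> \<Longrightarrow> vnorm N (x \<oplus> y) \<le> vnorm N x + vnorm N y"
    and vnorm_smult: "x \<in> carrier N \<Longrightarrow> vnorm N (c \<odot> x) = \<bar>c\<bar> * vnorm N x"
    and vnorm_definite: "\<lbrakk>x \<in> carrier N; vnorm N x = 0\<rbrakk> \<Longrightarrow> x = \<zero>"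
    and summable_complete: "\<lbrakk>\<And>n. X n \<in> carrier N; summable (\<lambda>n. vnorm N (X (Suc n) \<ominus> X n))\<rbrakk>
      \<Longrightarrow> \<exists>l\<in>carrier N. (\<lambda>n::nat. vnorm N (X n \<ominus> l)) \<longlonglongrightarrow> 0"
begin

section \<open>Distances in a normed module\<close>

definition vdist :: "'v \<Rightarrow> 'v \<Rightarrow> real" where
  "vdist x y = vnorm N (x \<ominus> y)"

lemma smult_closed' [simp, intro]: "x \<in> carrier N \<Longrightarrow> c \<odot> x \<in> carrier N"
  by (rule smult_closed) simp_all

lemma vnorm_zero [simp]: "vnorm N \<zero> = 0"
  using vnorm_smult[of "\<zero>" 0] smult_l_null[of "\<zero>"] by simp

lemma uminus_eq_smult: "y \<in> carrier N \<Longrightarrow> \<ominus> y = (- 1) \<odot> y"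
proof -
  assume y: "y \<in> carrier N"
  have "((- 1) \<odot> y) \<oplus> y = \<zero>"
    using y smult_l_distr[of "-1" 1 y] smult_one[of y] smult_l_null[OF y] by simp
  then show ?thesis using y by (intro minus_equality) auto
qed

lemma vnorm_uminus: "x \<in> carrier N \<Longrightarrow> vnorm N (\<ominus> x) = vnorm N x"
  by (simp add: uminus_eq_smult vnorm_smult)

lemma vnorm_nonneg: "x \<in> carrier N \<Longrightarrow> 0 \<le> vnorm N x"
  using vnorm_add[of x "\<ominus> x"] by (simp add: vnorm_uminus M.r_neg)

lemma vdist_nonneg: "x \<in> carrier N \<Longrightarrow> y \<in> carrier N \<Longrightarrow> 0 \<le> vdist x y"
  unfolding vdist_def by (intro vnorm_nonneg) auto

lemma vdist_commute: "x \<in> carrier N \<Longrightarrow> y \<in> carrier N \<Longrightarrow> vdist x y = vdist y x"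
  using vnorm_uminus[of "x \<ominus> y"] by (simp add: vdist_def a_minus_def M.minus_add M.a_comm)

lemma vdist_triangle:
  assumes "x \<in> carrier N" "y \<in> carrier N" "z \<in> carrier N"
  shows "vdist x z \<le> vdist x y + vdist y z"
proof -
  have "x \<ominus> z = (x \<ominus> y) \<oplus> (y \<ominus> z)"
    using assms by (simp add: a_minus_def M.a_assoc M.r_neg1)
  then show ?thesis using assms vnorm_add[of "x \<ominus> y" "y \<ominus> z"] by (simp add: vdist_def)
qed

lemma vdist_zero: "x \<in> carrier N \<Longrightarrow> vdist x \<zero> = vnorm N x"
  by (simp add: vdist_def a_minus_def uminus_eq_smult)

lemma vdist_refl: "x \<in> carrier N \<Longrightarrow> vdist x x = 0"
  by (simp add: vdist_def a_minus_def M.r_neg)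

lemma vdist_eq_0D:
  assumes "x \<in> carrier N" "y \<in> carrier N" "vdist x y = 0"
  shows "x = y"
proof -
  have "x \<ominus> y = \<zero>" using assms by (intro vnorm_definite) (auto simp: vdist_def)
  then have "\<ominus> (\<ominus> y) = x" using assms by (intro minus_equality) (auto simp: a_minus_def)
  then show ?thesis using assms by simp
qed

lemma add_minus_add:
  assumes "x \<in> carrier N" "y \<in> carrier N" "x' \<in> carrier N" "y' \<in> carrier N"
  shows "(x \<oplus> y) \<ominus> (x' \<oplus> y') = (x \<ominus> x') \<oplus> (y \<ominus> y')"
  using assms by (simp add: a_minus_def M.minus_add M.a_ac)

lemma vdist_add:
  assumes "x \<in> carrier N" "y \<in> carrier N" "x' \<in> carrier N" "y' \<in> carrier N"
  shows "vdist (x \<oplus> y) (x' \<oplus> y') \<le> vdist x x' + vdist y y'"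
  using assms vnorm_add[of "x \<ominus> x'" "y \<ominus> y'"] by (simp add: vdist_def add_minus_add)

lemma vdist_add_right:
  assumes "x \<in> carrier N" "y \<in> carrier N" "z \<in> carrier N"
  shows "vdist (x \<oplus> z) (y \<oplus> z) = vdist x y"
  using assms by (simp add: vdist_def add_minus_add) (simp add: a_minus_def M.r_neg)

lemma smult_minus:
  assumes "x \<in> carrier N" "y \<in> carrier N"
  shows "c \<odot> x \<ominus> c \<odot> y = c \<odot> (x \<ominus> y)"
  using assms smult_r_distr[of c x "\<ominus> y"] smult_r_minus[of c y] by (simp add: a_minus_def)

lemma vdist_smult: "x \<in> carrier N \<Longrightarrow> y \<in> carrier N \<Longrightarrow> vdist (c \<odot> x) (c \<odot> y) = \<bar>c\<bar> * vdist x y"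
  by (simp add: vdist_def smult_minus vnorm_smult)

section \<open>Closure of a submodule\<close>

definition vclosure :: "'v set \<Rightarrow> 'v set" where
  "vclosure D = {v \<in> carrier N. \<forall>e>0. \<exists>d\<in>D. vdist v d < e}"

lemma vclosureD: "v \<in> vclosure D \<Longrightarrow> e > 0 \<Longrightarrow> \<exists>d\<in>D. vdist v d < e"
  by (simp add: vclosure_def)

lemma vclosure_carrier: "v \<in> vclosure D \<Longrightarrow> v \<in> carrier N"
  by (simp add: vclosure_def)

lemma subset_vclosure: "D \<subseteq> carrier N \<Longrightarrow> D \<subseteq> vclosure D"
  by (force simp: vclosure_def vdist_refl)

text \<open>The free factor \<open>K\<close> allows several errors of order \<open>e\<close> to be
  added up without splitting \<open>e\<close> in advance.\<close>

lemma vclosureI: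
  assumes "v \<in> carrier N" and "\<And>e. e > 0 \<Longrightarrow> \<exists>d\<in>D. vdist v d \<le> K * e"
  shows "v \<in> vclosure D"
  unfolding vclosure_def
proof (intro CollectI conjI allI impI assms(1))
  fix e :: real assume e: "e > 0"
  obtain d where "d \<in> D" "vdist v d \<le> K * (e / (2 * (\<bar>K\<bar> + 1)))"
    using assms(2)[of "e / (2 * (\<bar>K\<bar> + 1))"] e by auto
  moreover have "K * (e / (2 * (\<bar>K\<bar> + 1))) \<le> (\<bar>K\<bar> + 1) * (e / (2 * (\<bar>K\<bar> + 1)))"
    using e by (intro mult_right_mono) auto
  moreover have "\<dots> = e / 2" by (simp add: field_simps)
  ultimately show "\<exists>d\<in>D. vdist v d < e" using e by (intro bexI[of _ d]) auto
qed

lemma closed_subspace_vclosure: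
  assumes D: "submodule D scalars N"
  shows "closed_subspace (vclosure D) N"
proof -
  have sub: "D \<subseteq> carrier N" by (rule submoduleE(1)[OF D])
  have smult: "c \<odot> x \<in> vclosure D" if x: "x \<in> vclosure D" for c x
  proof (rule vclosureI)
    fix e :: real assume "e > 0"
    then obtain d where d: "d \<in> D" "vdist x d < e" using vclosureD[OF x] by blast
    have "vdist (c \<odot> x) (c \<odot> d) \<le> \<bar>c\<bar> * e"
      using d sub vclosure_carrier[OF x] by (subst vdist_smult) (auto intro: mult_left_mono)
    then show "\<exists>d\<in>D. vdist (c \<odot> x) d \<le> \<bar>c\<bar> * e"
      using submoduleE(4)[OF D] d by (intro bexI[of _ "c \<odot> d"]) auto
  qed (use vclosure_carrier[OF x] in auto)
  show ?thesis
    unfolding closed_subspace_def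
  proof (intro conjI allI impI submoduleI)
    show "vclosure D \<subseteq> carrier N" using vclosure_carrier by blast
    have "\<zero> \<in> D" using submodule.axioms(1)[OF D] subgroup.one_closed by fastforce
    then show "\<zero> \<in> vclosure D" using subset_vclosure[OF sub] by blast
    show "\<ominus> x \<in> vclosure D" if "x \<in> vclosure D" for x
      using smult[OF that] vclosure_carrier[OF that] by (simp add: uminus_eq_smult)
    show "c \<odot> x \<in> vclosure D" if "x \<in> vclosure D" for c x
      using that by (rule smult)
    show "x \<oplus> y \<in> vclosure D" if x: "x \<in> vclosure D" and y: "y \<in> vclosure D" for x y
    proof (rule vclosureI)
      fix e :: real assume e: "e > 0"
      obtain d d' where d: "d \<in> D" "vdist x d < e" "d' \<in> D" "vdist y d' < e"
        using vclosureD[OF x e] vclosureD[OF y e] by blast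
      have "vdist (x \<oplus> y) (d \<oplus> d') \<le> vdist x d + vdist y d'"
        using d sub vclosure_carrier x y by (intro vdist_add) auto
      then show "\<exists>d\<in>D. vdist (x \<oplus> y) d \<le> 2 * e"
        using submoduleE(5)[OF D] d by (intro bexI[of _ "d \<oplus> d'"]) auto
    qed (use vclosure_carrier x y in auto)
  next
    fix X l
    assume A: "(\<forall>n::nat. X n \<in> vclosure D) \<and> l \<in> carrier N \<and> (\<lambda>n. vnorm N (X n \<ominus> l)) \<longlonglongrightarrow> 0"
    show "l \<in> vclosure D"
    proof (rule vclosureI)
      fix e :: real assume e: "e > 0"
      have "\<forall>\<^sub>F n in sequentially. vnorm N (X n \<ominus> l) < e"
        using A e by (auto intro: order_tendstoD)
      then obtain n where "vnorm N (X n \<ominus> l) < e" by (auto simp: eventually_sequentially)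
      then have n: "vdist (X n) l < e" by (simp add: vdist_def)
      obtain d where d: "d \<in> D" "vdist (X n) d < e" using A vclosureD e by blast
      have "vdist l d \<le> vdist (X n) l + vdist (X n) d"
        using vdist_triangle[of l "X n" d] vdist_commute[of l "X n"] A d sub vclosure_carrier by auto
      then show "\<exists>d\<in>D. vdist l d \<le> 2 * e" using d n by (intro bexI[of _ d]) auto
    qed (use A in auto)
  qed
qed

section \<open>Extension of a bounded map to the closure\<close>

text \<open>The bound is a parameter, so that one constant can serve all group elements.\<close>

definition bounded_endo :: "'v set \<Rightarrow> real \<Rightarrow> ('v \<Rightarrow> 'v) \<Rightarrow> bool" where
  "bounded_endo D C T \<longleftrightarrow> 0 \<le> C \<and> T \<in> D \<rightarrow> D \<and> (\<forall>x\<in>D. \<forall>y\<in>D. T (x \<oplus> y) = T x \<oplus> T y) \<and>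
    (\<forall>c. \<forall>x\<in>D. T (c \<odot> x) = c \<odot> T x) \<and> (\<forall>x\<in>D. vnorm N (T x) \<le> C * vnorm N x)"

lemma bounded_endo_vdist:
  assumes D: "submodule D scalars N" and T: "bounded_endo D C T" and x: "x \<in> D" and y: "y \<in> D"
  shows "vdist (T x) (T y) \<le> C * vdist x y"
proof -
  have mem: "x \<ominus> y \<in> D" "(- 1) \<odot> y \<in> D" "x \<in> carrier N" "y \<in> carrier N" "T y \<in> carrier N" "T x \<in> carrier N"
    using submoduleE(1,3,4,5)[OF D] x y T by (auto simp: a_minus_def bounded_endo_def)
  have "T (x \<ominus> y) = T x \<ominus> T y"
    using T x y mem by (simp add: a_minus_def uminus_eq_smult bounded_endo_def)
  then show ?thesis using T mem(1) by (metis bounded_endo_def vdist_def)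
qed

text \<open>The continuous extension to the closure, pinned down by its distances to the values on \<open>D\<close>
  so that neither sequences nor limits occur in its definition.\<close>

definition closure_extension :: "'v set \<Rightarrow> real \<Rightarrow> ('v \<Rightarrow> 'v) \<Rightarrow> 'v \<Rightarrow> 'v" where
  "closure_extension D C T v = (THE w. w \<in> carrier N \<and> (\<forall>d\<in>D. vdist w (T d) \<le> C * vdist v d))"

context
  fixes D C T
  assumes D: "submodule D scalars N" and T: "bounded_endo D C T"
begin

private lemma D_carrier: "d \<in> D \<Longrightarrow> d \<in> carrier N"
  using submoduleE(1)[OF D] by blast

private lemma T_mem: "d \<in> D \<Longrightarrow> T d \<in> D"
  using T by (auto simp: bounded_endo_def)

private lemma C_nonneg: "0 \<le> C"
  using T by (simp add: bounded_endo_def)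

text \<open>Both \<open>w\<close> and \<open>w'\<close> are close to the same \<open>T d\<close>.
  The condition on \<open>w\<close> asks for one approximant per scale, which is easy to check for
  sums, multiples and composites.\<close>

private lemma closure_extension_unique:
  assumes v: "v \<in> vclosure D" and w: "w \<in> carrier N" and w': "w' \<in> carrier N"
    and ext: "\<And>d. d \<in> D \<Longrightarrow> vdist w' (T d) \<le> C * vdist v d"
    and approx: "\<And>e. e > 0 \<Longrightarrow> \<exists>d\<in>D. vdist v d \<le> K * e \<and> vdist w (T d) \<le> K * e"
  shows "w = w'"
proof (rule ccontr)
  assume "w \<noteq> w'"
  then have pos: "vdist w w' > 0"
    using vdist_eq_0D[OF w w'] vdist_nonneg[OF w w'] by fastforce
  have le: "vdist w w' \<le> (1 + C) * K * e" if e: "e > 0" for e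
  proof -
    obtain d where d: "d \<in> D" "vdist v d \<le> K * e" "vdist w (T d) \<le> K * e"
      using approx[OF e] by blast
    have "vdist w w' \<le> vdist w (T d) + vdist w' (T d)"
      using vdist_triangle[of w "T d" w'] vdist_commute[of "T d" w'] w w' d T_mem D_carrier by auto
    also have "vdist w' (T d) \<le> C * (K * e)"
      using ext[OF d(1)] mult_left_mono[OF d(2) C_nonneg] by simp
    finally show ?thesis using d(3) by (simp add: algebra_simps)
  qed
  define m where "m = \<bar>(1 + C) * K\<bar> + 1"
  have m: "m > 0" "(1 + C) * K \<le> m" by (simp_all add: m_def)
  \<comment> \<open>At this scale the estimate would bound the positive distance by its
    half.\<close>
  have "vdist w w' \<le> (1 + C) * K * (vdist w w' / (2 * m))" 
    using pos m by (intro le) simp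
  also have "\<dots> \<le> m * (vdist w w' / (2 * m))" using pos m by (intro mult_right_mono) auto
  also have "\<dots> = vdist w w' / 2" using m by simp
  finally show False using pos by simp
qed

text \<open>Approximants with geometric errors have images with summable increments. The limit of
  these images inherits the distance bound.\<close>

private lemma closure_extension_exists:
  assumes v: "v \<in> vclosure D"
  shows "\<exists>w\<in>carrier N. \<forall>d\<in>D. vdist w (T d) \<le> C * vdist v d"
proof -
  have vc: "v \<in> carrier N" using v by (rule vclosure_carrier)
  have "\<forall>n. \<exists>d\<in>D. vdist v d < (1 / 2) ^ n"
    by (intro allI vclosureD[OF v]) simp
  then obtain d where d: "\<And>n::nat. d n \<in> D" "\<And>n. vdist v (d n) < (1 / 2) ^ n" by metis
  have Tc: "T (d n) \<in> carrier N" for n using d T_mem D_carrier by blast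
  have "summable (\<lambda>n. vnorm N (T (d (Suc n)) \<ominus> T (d n)))"
  proof (rule summable_comparison_test)
    show "\<exists>n0. \<forall>n\<ge>n0. norm (vnorm N (T (d (Suc n)) \<ominus> T (d n))) \<le> C * (2 * (1 / 2) ^ n)"
    proof (intro exI allI impI)
      fix n
      have "vdist (d (Suc n)) (d n) \<le> vdist v (d (Suc n)) + vdist v (d n)"
        using vdist_triangle[of "d (Suc n)" v "d n"] vdist_commute[of "d (Suc n)" v] vc d(1) D_carrier by auto
      also have "\<dots> \<le> (1 / 2) ^ Suc n + (1 / 2) ^ n"
        by (intro add_mono less_imp_le d)
      also have "\<dots> \<le> 2 * (1 / 2) ^ n" by simp
      finally have "C * vdist (d (Suc n)) (d n) \<le> C * (2 * (1 / 2) ^ n)"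
        using C_nonneg by (rule mult_left_mono)
      then have "vdist (T (d (Suc n))) (T (d n)) \<le> C * (2 * (1 / 2) ^ n)"
        using bounded_endo_vdist[OF D T d(1) d(1), of "Suc n" n] by simp
      then show "norm (vnorm N (T (d (Suc n)) \<ominus> T (d n))) \<le> C * (2 * (1 / 2) ^ n)"
        using vdist_nonneg[OF Tc Tc, of "Suc n" n] by (simp add: vdist_def)
    qed
  qed (intro summable_mult summable_geometric, simp)
  then obtain w where w: "w \<in> carrier N" "(\<lambda>n. vdist (T (d n)) w) \<longlonglongrightarrow> 0"
    using summable_complete[of "\<lambda>n. T (d n)"] Tc by (auto simp: vdist_def)
  have "vdist w (T x) \<le> C * vdist v x" if x: "x \<in> D" for x
  proof (rule LIMSEQ_le_const)
    have "(\<lambda>n. (1 / 2 :: real) ^ n) \<longlonglongrightarrow> 0" by (rule LIMSEQ_realpow_zero) auto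
    then have "(\<lambda>n. vdist (T (d n)) w + C * ((1 / 2) ^ n + vdist v x)) \<longlonglongrightarrow> 0 + C * (0 + vdist v x)"
      by (intro tendsto_intros w) simp
    then show "(\<lambda>n. vdist (T (d n)) w + C * ((1 / 2) ^ n + vdist v x)) \<longlonglongrightarrow> C * vdist v x" by simp
    show "\<exists>n0. \<forall>n\<ge>n0. vdist w (T x) \<le> vdist (T (d n)) w + C * ((1 / 2) ^ n + vdist v x)"
    proof (intro exI allI impI)
      fix n
      have "vdist (d n) x \<le> vdist v (d n) + vdist v x"
        using vdist_triangle[of "d n" v x] vdist_commute[of "d n" v] vc x d(1) D_carrier by auto
      also have "\<dots> \<le> (1 / 2) ^ n + vdist v x"
        using d(2)[of n] by simp
      finally have "C * vdist (d n) x \<le> C * ((1 / 2) ^ n + vdist v x)"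
        using C_nonneg by (rule mult_left_mono)
      moreover have "vdist w (T x) \<le> vdist (T (d n)) w + vdist (T (d n)) (T x)"
        using vdist_triangle[of w "T (d n)" "T x"] vdist_commute[of w "T (d n)"] w(1) Tc x T_mem D_carrier by auto
      moreover have "vdist (T (d n)) (T x) \<le> C * vdist (d n) x"
        by (rule bounded_endo_vdist[OF D T d(1) x])
      ultimately show "vdist w (T x) \<le> vdist (T (d n)) w + C * ((1 / 2) ^ n + vdist v x)" by linarith
    qed
  qed
  then show ?thesis using w by blast
qed

private lemma closure_extension_props:
  assumes v: "v \<in> vclosure D"
  shows "closure_extension D C T v \<in> carrier N"
    and "d \<in> D \<Longrightarrow> vdist (closure_extension D C T v) (T d) \<le> C * vdist v d"
proof -
  let ?P = "\<lambda>w. w \<in> carrier N \<and> (\<forall>d\<in>D. vdist w (T d) \<le> C * vdist v d)"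
  have "\<exists>!w. ?P w"
  proof (rule ex_ex1I)
    show "\<exists>w. ?P w" using closure_extension_exists[OF v] by blast
    fix w w' assume ww: "?P w" "?P w'"
    \<comment> \<open>The defining bound itself supplies the approximants; \<open>1 + C\<close>
      majorises both 1 and \<open>C\<close>.\<close>
    have "\<exists>d\<in>D. vdist v d \<le> (1 + C) * e \<and> vdist w (T d) \<le> (1 + C) * e" if e: "e > 0" for e
    proof -
      obtain d where d: "d \<in> D" "vdist v d < e" using vclosureD[OF v e] by blast
      have "vdist w (T d) \<le> C * vdist v d" using ww d by blast
      also have "\<dots> \<le> C * e" using d C_nonneg by (intro mult_left_mono) auto
      moreover have "0 \<le> C * e" using C_nonneg e by simp
      ultimately show ?thesis using d e by (intro bexI[of _ d]) (auto simp: algebra_simps)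
    qed
    then show "w = w'" using ww by (intro closure_extension_unique[OF v]) auto
  qed
  from theI'[OF this] show "closure_extension D C T v \<in> carrier N"
    "d \<in> D \<Longrightarrow> vdist (closure_extension D C T v) (T d) \<le> C * vdist v d"
    unfolding closure_extension_def by blast+
qed

text \<open>The tool for every identity of the extension: a candidate value is confirmed by
  approximating argument and value simultaneously.\<close>

lemma closure_extension_eqI:
  assumes "v \<in> vclosure D" and "w \<in> carrier N"
    and "\<And>e. e > 0 \<Longrightarrow> \<exists>d\<in>D. vdist v d \<le> K * e \<and> vdist w (T d) \<le> K * e"
  shows "closure_extension D C T v = w"
  using closure_extension_unique[OF assms(1,2) closure_extension_props[OF assms(1)] assms(3)] by simp

lemma closure_extension_approx:
  assumes v: "v \<in> vclosure D" and e: "e > 0"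
  obtains d where "d \<in> D" "vdist v d \<le> (1 + C) * e" "vdist (closure_extension D C T v) (T d) \<le> (1 + C) * e"
proof -
  obtain d where d: "d \<in> D" "vdist v d < e" using vclosureD[OF v e] by blast
  have "vdist (closure_extension D C T v) (T d) \<le> C * vdist v d"
    using closure_extension_props(2)[OF v d(1)] .
  also have "\<dots> \<le> C * e" using d C_nonneg by (intro mult_left_mono) auto
  moreover have "0 \<le> C * e" using C_nonneg e by simp
  ultimately show thesis using d e by (intro that[of d]) (auto simp: algebra_simps)
qed

lemma closure_extension_eq: "d \<in> D \<Longrightarrow> closure_extension D C T d = T d"
  using subset_vclosure submoduleE(1)[OF D] D_carrier T_mem
  by (intro closure_extension_eqI[of _ _ 0]) (auto simp: vdist_refl intro!: bexI[of _ d])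

lemma bounded_endo_closure_extension: "bounded_endo (vclosure D) C (closure_extension D C T)"
  unfolding bounded_endo_def
proof (intro conjI ballI allI C_nonneg)
  let ?T = "closure_extension D C T"
  note vc = vclosure_carrier
  show "?T \<in> vclosure D \<rightarrow> vclosure D"
  proof
    fix v assume v: "v \<in> vclosure D"
    show "?T v \<in> vclosure D"
    proof (rule vclosureI)
      show "\<exists>d\<in>D. vdist (?T v) d \<le> (1 + C) * e" if "e > 0" for e
        using closure_extension_approx[OF v that] T_mem by metis
    qed (rule closure_extension_props[OF v])
  qed
  have E: "submodule (vclosure D) scalars N"
    using closed_subspace_vclosure[OF D] by (simp add: closed_subspace_def)
  show "?T (x \<oplus> y) = ?T x \<oplus> ?T y" if x: "x \<in> vclosure D" and y: "y \<in> vclosure D" for x y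
  proof (rule closure_extension_eqI)
    fix e :: real assume e: "e > 0"
    obtain d where d: "d \<in> D" "vdist x d \<le> (1 + C) * e" "vdist (?T x) (T d) \<le> (1 + C) * e"
      by (rule closure_extension_approx[OF x e])
    obtain d' where d': "d' \<in> D" "vdist y d' \<le> (1 + C) * e" "vdist (?T y) (T d') \<le> (1 + C) * e"
      by (rule closure_extension_approx[OF y e])
    have "vdist (x \<oplus> y) (d \<oplus> d') \<le> vdist x d + vdist y d'"
      "vdist (?T x \<oplus> ?T y) (T d \<oplus> T d') \<le> vdist (?T x) (T d) + vdist (?T y) (T d')"
      using x y d d' vc D_carrier T_mem closure_extension_props(1) by (auto intro!: vdist_add)
    moreover have "T (d \<oplus> d') = T d \<oplus> T d'" using T d d' by (simp add: bounded_endo_def)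
    ultimately show "\<exists>d\<in>D. vdist (x \<oplus> y) d \<le> (2 * (1 + C)) * e \<and> vdist (?T x \<oplus> ?T y) (T d) \<le> (2 * (1 + C)) * e"
      using d d' submoduleE(5)[OF D] by (intro bexI[of _ "d \<oplus> d'"]) (auto simp: algebra_simps)
  qed (use x y submoduleE(5)[OF E] closure_extension_props(1) in auto)
  show "?T (c \<odot> x) = c \<odot> ?T x" if x: "x \<in> vclosure D" for c x
  proof (rule closure_extension_eqI)
    fix e :: real assume e: "e > 0"
    obtain d where d: "d \<in> D" "vdist x d \<le> (1 + C) * e" "vdist (?T x) (T d) \<le> (1 + C) * e"
      by (rule closure_extension_approx[OF x e])
    have "vdist (c \<odot> x) (c \<odot> d) = \<bar>c\<bar> * vdist x d" "vdist (c \<odot> ?T x) (c \<odot> T d) = \<bar>c\<bar> * vdist (?T x) (T d)"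
      using x d vc D_carrier T_mem closure_extension_props(1) by (auto intro!: vdist_smult)
    moreover have "T (c \<odot> d) = c \<odot> T d" using T d by (simp add: bounded_endo_def)
    moreover have "\<bar>c\<bar> * vdist x d \<le> \<bar>c\<bar> * ((1 + C) * e)" "\<bar>c\<bar> * vdist (?T x) (T d) \<le> \<bar>c\<bar> * ((1 + C) * e)"
      using d by (auto intro!: mult_left_mono)
    ultimately show "\<exists>d\<in>D. vdist (c \<odot> x) d \<le> (\<bar>c\<bar> * (1 + C)) * e \<and> vdist (c \<odot> ?T x) (T d) \<le> (\<bar>c\<bar> * (1 + C)) * e"
      using d submoduleE(4)[OF D] by (intro bexI[of _ "c \<odot> d"]) (auto simp: mult.assoc)
  qed (use x submoduleE(4)[OF E] closure_extension_props(1) in auto)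
  show "vnorm N (?T x) \<le> C * vnorm N x" if x: "x \<in> vclosure D" for x
  proof -
    \<comment> \<open>The norm bound is the distance bound at \<open>d = \<zero>\<close>, once
      \<open>T \<zero> = \<zero>\<close> is known.\<close>
    have z: "\<zero> \<in> D" using submodule.axioms(1)[OF D] subgroup.one_closed by fastforce
    then have "vnorm N (T \<zero>) \<le> 0" using T by (force simp: bounded_endo_def)
    then have "T \<zero> = \<zero>" using z T_mem D_carrier vnorm_nonneg[of "T \<zero>"] vnorm_definite[of "T \<zero>"] by force
    then show ?thesis using closure_extension_props[OF x] z vc[OF x] by (force simp: vdist_zero)
  qed
qed

end

section \<open>Affine actions on the closure\<close>

lemma module_subspace: "submodule E scalars N \<Longrightarrow> module scalars (N\<lparr>carrier := E\<rparr>)"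
  using submodule.submodule_is_module module_axioms by blast

text \<open>Negation in the restricted record refers to its own carrier, so agreement needs
  uniqueness of additive inverses.\<close>

lemma minus_subspace:
  assumes E: "submodule E scalars N" and x: "x \<in> E" "y \<in> E"
  shows "x \<ominus>\<^bsub>N\<lparr>carrier := E\<rparr>\<^esub> y = x \<ominus> y"
proof -
  interpret E: module scalars "N\<lparr>carrier := E\<rparr>" by (rule module_subspace[OF E])
  have "\<ominus> y \<in> E" "y \<in> carrier N" using submoduleE(1,3)[OF E] x by auto
  then have "\<ominus>\<^bsub>N\<lparr>carrier := E\<rparr>\<^esub> y = \<ominus> y"
    using x by (intro E.minus_equality) (auto simp: M.l_neg)
  then show ?thesis by (simp add: a_minus_def)
qed

text \<open>The group laws pass to the closure because extensions are determined by approximation.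
  Properness at an arbitrary \<open>v\<close> reduces to growth of \<open>b\<close>, as the linear
  part moves \<open>v\<close> by a bounded amount.\<close>

theorem extend_affine_action:
  fixes G :: "('g, 'n) monoid_scheme"
  assumes G: "group G" and D: "submodule D scalars N" and C: "C \<ge> 1"
    and T: "\<And>s. s \<in> carrier G \<Longrightarrow> bounded_endo D C (T s)"
    and T_mult: "\<And>s t d. \<lbrakk>s \<in> carrier G; t \<in> carrier G; d \<in> D\<rbrakk> \<Longrightarrow> T (s \<otimes>\<^bsub>G\<^esub> t) d = T s (T t d)"
    and T_one: "\<And>d. d \<in> D \<Longrightarrow> T \<one>\<^bsub>G\<^esub> d = d"
    and b: "b \<in> carrier G \<rightarrow> D"
    and cocycle: "\<And>s t. \<lbrakk>s \<in> carrier G; t \<in> carrier G\<rbrakk> \<Longrightarrow> b (s \<otimes>\<^bsub>G\<^esub> t) = T s (b t) \<oplus> b s"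
    and proper: "\<And>R. finite {s \<in> carrier G. vnorm N (b s) \<le> R}"
  shows "\<exists>E \<pi>. closed_subspace E N \<and> affine_action G (N\<lparr>carrier := E\<rparr>) \<pi> b \<and>
    uniformly_lipschitz G (N\<lparr>carrier := E\<rparr>) (affine_map (N\<lparr>carrier := E\<rparr>) \<pi> b) \<and>
    proper_action G (N\<lparr>carrier := E\<rparr>) (affine_map (N\<lparr>carrier := E\<rparr>) \<pi> b)"
proof -
  interpret G: group G by fact
  define E where "E = vclosure D"
  let ?N = "N\<lparr>carrier := E\<rparr>"
  \<comment> \<open>Elements of \<open>Bij\<close> are extensional, hence the restriction.\<close>
  define \<pi> where "\<pi> s = restrict (closure_extension D C (T s)) E" for s
  have closed: "closed_subspace E N" unfolding E_def by (rule closed_subspace_vclosure[OF D])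
  then have E: "submodule E scalars N" by (simp add: closed_subspace_def)
  have Ec: "x \<in> carrier N" if "x \<in> E" for x using submoduleE(1)[OF E] that by blast
  have DE: "d \<in> E" if "d \<in> D" for d
    using subset_vclosure[OF submoduleE(1)[OF D]] that by (auto simp: E_def)
  have \<pi>: "bounded_endo E C (\<pi> s)" if s: "s \<in> carrier G" for s
    using bounded_endo_closure_extension[OF D T[OF s]] submoduleE(4,5)[OF E]
    by (auto simp: bounded_endo_def \<pi>_def E_def[symmetric])
  have \<pi>_mem: "\<pi> s v \<in> E" if "s \<in> carrier G" "v \<in> E" for s v
    using \<pi>[OF that(1)] that(2) by (auto simp: bounded_endo_def)
  have \<pi>_D: "\<pi> s d = T s d" if "s \<in> carrier G" "d \<in> D" for s d
    using closure_extension_eq[OF D T[OF that(1)] that(2)] DE[OF that(2)] by (simp add: \<pi>_def)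
  have \<pi>_mult: "\<pi> (s \<otimes>\<^bsub>G\<^esub> t) v = \<pi> s (\<pi> t v)" if s: "s \<in> carrier G" and t: "t \<in> carrier G" and v: "v \<in> E" for s t v
  proof -
    \<comment> \<open>The composite passes the approximation test: it is Lipschitz with constant
      \<open>C * C\<close>, and \<open>1 + C * C\<close> bounds both errors.\<close>
    have "closure_extension D C (T (s \<otimes>\<^bsub>G\<^esub> t)) v = \<pi> s (\<pi> t v)"
    proof (rule closure_extension_eqI[OF D T])
      fix e :: real assume e: "e > 0"
      obtain d where d: "d \<in> D" "vdist v d < e" using vclosureD[OF v[unfolded E_def] e] by blast
      have Td: "T t d \<in> D" using T[OF t] d by (auto simp: bounded_endo_def)
      have "vdist (\<pi> s (\<pi> t v)) (T (s \<otimes>\<^bsub>G\<^esub> t) d) = vdist (\<pi> s (\<pi> t v)) (\<pi> s (\<pi> t d))"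
        using s t d Td by (simp add: \<pi>_D T_mult)
      also have "\<dots> \<le> C * vdist (\<pi> t v) (\<pi> t d)"
        using s t v d DE \<pi>_mem by (intro bounded_endo_vdist[OF E \<pi>]) auto
      also have "\<dots> \<le> C * (C * vdist v d)"
        using t v d DE C by (intro mult_left_mono bounded_endo_vdist[OF E \<pi>]) auto
      also have "\<dots> \<le> C * (C * e)" using d C by (intro mult_left_mono) auto
      also have "\<dots> \<le> (1 + C * C) * e" using e by (simp add: algebra_simps)
      finally have "vdist (\<pi> s (\<pi> t v)) (T (s \<otimes>\<^bsub>G\<^esub> t) d) \<le> (1 + C * C) * e" .
      moreover have "vdist v d \<le> (1 + C * C) * e"
      proof -
        have "0 \<le> C * C * e" using C e by simp
        then show ?thesis using d by (simp add: algebra_simps)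
      qed
      ultimately show "\<exists>d\<in>D. vdist v d \<le> (1 + C * C) * e \<and>
          vdist (\<pi> s (\<pi> t v)) (T (s \<otimes>\<^bsub>G\<^esub> t) d) \<le> (1 + C * C) * e"
        using d by blast
    qed (use s t v \<pi>_mem Ec in \<open>auto simp: E_def[symmetric]\<close>)
    then show ?thesis using v by (simp add: \<pi>_def)
  qed
  have \<pi>_one: "\<pi> \<one>\<^bsub>G\<^esub> v = v" if v: "v \<in> E" for v
  proof -
    have "closure_extension D C (T \<one>\<^bsub>G\<^esub>) v = v"
    proof (rule closure_extension_eqI[OF D T])
      show "\<exists>d\<in>D. vdist v d \<le> 1 * e \<and> vdist v (T \<one>\<^bsub>G\<^esub> d) \<le> 1 * e" if "e > 0" for e
        using vclosureD[OF v[unfolded E_def] that] T_one by force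
    qed (use v Ec in \<open>auto simp: E_def[symmetric]\<close>)
    then show ?thesis using v by (simp add: \<pi>_def)
  qed
  \<comment> \<open>The group inverse provides a two-sided inverse of the same kind, hence both
    bijectivity and boundedness of the inverse.\<close>
  have \<pi>_inv: "\<pi> (inv\<^bsub>G\<^esub> s) (\<pi> s v) = v" "\<pi> s (\<pi> (inv\<^bsub>G\<^esub> s) v) = v"
    if "s \<in> carrier G" "v \<in> E" for s v
    using that by (simp_all add: \<pi>_mult[symmetric] \<pi>_one)
  have bij: "bij_betw (\<pi> s) E E" if "s \<in> carrier G" for s
    by (rule bij_betw_byWitness[of _ "\<pi> (inv\<^bsub>G\<^esub> s)"]) (use that \<pi>_inv \<pi>_mem in auto)
  have Bij: "\<pi> s \<in> Bij E" if "s \<in> carrier G" for s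
    using bij[OF that] by (simp add: Bij_def \<pi>_def)
  have linear: "bounded_linear_on ?N (\<pi> s)" if "s \<in> carrier G" for s
    using \<pi>[OF that] by (auto simp: bounded_linear_on_def bounded_endo_def)
  have inv: "inv_into E (\<pi> s) v = \<pi> (inv\<^bsub>G\<^esub> s) v" if "s \<in> carrier G" "v \<in> E" for s v
    using that bij[OF that(1)] \<pi>_inv \<pi>_mem by (intro inv_into_f_eq) (auto simp: bij_betw_def)
  have inv_linear: "bounded_linear_on ?N (inv_into E (\<pi> s))" if s: "s \<in> carrier G" for s
    using linear[of "inv\<^bsub>G\<^esub> s"] s submoduleE(4,5)[OF E]
    by (auto simp: bounded_linear_on_def inv Pi_iff)
  have "\<pi> \<in> hom G (GL ?N)"
  proof (rule homI)
    show "\<pi> s \<in> carrier (GL ?N)" if "s \<in> carrier G" for s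
      using Bij[OF that] linear[OF that] inv_linear[OF that] by (simp add: GL_def)
    show "\<pi> (s \<otimes>\<^bsub>G\<^esub> t) = \<pi> s \<otimes>\<^bsub>GL ?N\<^esub> \<pi> t" if "s \<in> carrier G" "t \<in> carrier G" for s t
    proof -
      have "\<pi> s \<otimes>\<^bsub>GL ?N\<^esub> \<pi> t = compose E (\<pi> s) (\<pi> t)"
        using that Bij by (simp add: GL_def BijGroup_def)
      also have "\<dots> = \<pi> (s \<otimes>\<^bsub>G\<^esub> t)"
        using that \<pi>_mult by (intro extensionalityI[of _ E]) (auto simp: compose_eq \<pi>_def)
      finally show ?thesis by simp
    qed
  qed
  then have action: "affine_action G ?N \<pi> b"
    using b DE cocycle by (auto simp: affine_action_def \<pi>_D Pi_iff)
  have bE: "b s \<in> E" if "s \<in> carrier G" for s using b DE that by auto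
  have \<sigma>: "affine_map ?N \<pi> b s v \<in> E" "affine_map ?N \<pi> b s v = \<pi> s v \<oplus> b s" "b s \<in> carrier N" "\<pi> s v \<in> carrier N"
    if "s \<in> carrier G" "v \<in> E" for s v
    using that bE \<pi>_mem Ec submoduleE(5)[OF E] by (auto simp: affine_map_def)
  have lipschitz: "vnorm ?N (affine_map ?N \<pi> b s v \<ominus>\<^bsub>?N\<^esub> affine_map ?N \<pi> b s w) \<le> C * vnorm ?N (v \<ominus>\<^bsub>?N\<^esub> w)"
    if "s \<in> carrier G" "v \<in> E" "w \<in> E" for s v w
    using bounded_endo_vdist[OF E \<pi>[OF that(1)] that(2,3)] that \<sigma> vdist_add_right[of "\<pi> s v" "\<pi> s w" "b s"]
    by (simp add: minus_subspace[OF E]) (simp add: vdist_def)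
  have "finite {s \<in> carrier G. vnorm ?N (affine_map ?N \<pi> b s v \<ominus>\<^bsub>?N\<^esub> v) \<le> R}" if v: "v \<in> E" for v R
  proof (rule finite_subset)
    \<comment> \<open>The displacement of \<open>v\<close> and \<open>b s\<close> differ by
      \<open>\<pi> s v - v\<close>, whose norm is at most \<open>1 + C\<close> times that of
      \<open>v\<close>.\<close>
    show "{s \<in> carrier G. vnorm ?N (affine_map ?N \<pi> b s v \<ominus>\<^bsub>?N\<^esub> v) \<le> R}
      \<subseteq> {s \<in> carrier G. vnorm N (b s) \<le> R + vnorm N v + C * vnorm N v}"
    proof clarify
      fix s assume s: "s \<in> carrier G" and "vnorm ?N (affine_map ?N \<pi> b s v \<ominus>\<^bsub>?N\<^esub> v) \<le> R"
      then have le: "vdist (\<pi> s v \<oplus> b s) v \<le> R"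
        using \<sigma> v by (simp add: minus_subspace[OF E]) (simp add: vdist_def)
      have c: "\<pi> s v \<in> carrier N" "b s \<in> carrier N" "v \<in> carrier N" using \<sigma>[OF s v] Ec v by auto
      have "vnorm N (b s) = vdist (\<pi> s v \<oplus> b s) (\<pi> s v)"
        using c vdist_add_right[of "b s" "\<zero>" "\<pi> s v"] by (simp add: vdist_zero M.a_comm)
      also have "\<dots> \<le> vdist (\<pi> s v \<oplus> b s) v + vdist v (\<pi> s v)"
        using c by (intro vdist_triangle) auto
      also have "vdist v (\<pi> s v) \<le> vnorm N v + vnorm N (\<pi> s v)"
        using c vdist_triangle[of v "\<zero>" "\<pi> s v"] vdist_commute[of "\<zero>" "\<pi> s v"] by (simp add: vdist_zero)
      also have "vnorm N (\<pi> s v) \<le> C * vnorm N v"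
        using \<pi>[OF s] v by (auto simp: bounded_endo_def)
      finally show "vnorm N (b s) \<le> R + vnorm N v + C * vnorm N v" using le by linarith
    qed
  qed (rule proper)
  then have "proper_action G ?N (affine_map ?N \<pi> b)"
    by (simp add: proper_action_def)
  moreover have "uniformly_lipschitz G ?N (affine_map ?N \<pi> b)"
    unfolding uniformly_lipschitz_def using C lipschitz by (intro exI[of _ C]) simp
  ultimately show ?thesis using closed action by blast
qed

end

text \<open>Completeness is the Riesz-Fischer argument: increments with summable norms converge
  absolutely almost everywhere, and dominated convergence upgrades this to convergence in
  norm.\<close>

lemma banach_module_L1: "banach_module (L1 M)"
proof (intro banach_module.intro module_L1 banach_module_axioms.intro)
  show "vnorm (L1 M) (x \<oplus>\<^bsub>L1 M\<^esub> y) \<le> vnorm (L1 M) x + vnorm (L1 M) y"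
    if xy: "x \<in> carrier (L1 M)" "y \<in> carrier (L1 M)" for x y
  proof -
    obtain f where f: "x = L1_class M f" "integrable M f" using xy(1) by (auto simp: carrier_L1)
    obtain g where g: "y = L1_class M g" "integrable M g" using xy(2) by (auto simp: carrier_L1)
    have "(\<integral>x. \<bar>f x + g x\<bar> \<partial>M) \<le> (\<integral>x. \<bar>f x\<bar> + \<bar>g x\<bar> \<partial>M)"
      using f g by (intro integral_mono) auto
    then show ?thesis using f g by (simp add: add_L1 vnorm_L1)
  qed
  show "vnorm (L1 M) (c \<odot>\<^bsub>L1 M\<^esub> x) = \<bar>c\<bar> * vnorm (L1 M) x" if "x \<in> carrier (L1 M)" for c x
    using that by (auto simp: carrier_L1 smult_L1 vnorm_L1 abs_mult)
  show "x = \<zero>\<^bsub>L1 M\<^esub>" if x: "x \<in> carrier (L1 M)" "vnorm (L1 M) x = 0" for x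
  proof -
    obtain f where f: "x = L1_class M f" "integrable M f" using x(1) by (auto simp: carrier_L1)
    then have "(\<integral>x. \<bar>f x\<bar> \<partial>M) = 0" using x(2) by (simp add: vnorm_L1)
    then have "AE x in M. \<bar>f x\<bar> = 0"
      using f by (subst (asm) integral_nonneg_eq_0_iff_AE) auto
    then show ?thesis using f by (simp add: zero_L1 L1_class_eq_iff)
  qed
next
  fix X
  assume X: "\<And>n. X n \<in> carrier (L1 M)"
    and summable: "summable (\<lambda>n. vnorm (L1 M) (X (Suc n) \<ominus>\<^bsub>L1 M\<^esub> X n))"
  have "\<forall>n. \<exists>f. X n = L1_class M f \<and> integrable M f" using X by (auto simp: carrier_L1)
  then obtain f where f: "\<And>n. X n = L1_class M (f n)" "\<And>n. integrable M (f n)" by metis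
  define h where "h n x = f (Suc n) x - f n x" for n x
  have h: "integrable M (h n)" for n unfolding h_def using f by auto
  note [measurable] = borel_measurable_integrable[OF h]
  have int: "summable (\<lambda>n. \<integral>x. norm (h n x) \<partial>M)"
    using summable f by (simp add: minus_L1 vnorm_L1 h_def)
  \<comment> \<open>A finite integral of the series of absolute increments makes that series finite
    almost everywhere.\<close>
  have "(\<integral>\<^sup>+x. (\<Sum>n. ennreal (norm (h n x))) \<partial>M) = (\<Sum>n. \<integral>\<^sup>+x. ennreal (norm (h n x)) \<partial>M)"
    by (rule nn_integral_suminf) measurable
  also have "\<dots> = (\<Sum>n. ennreal (\<integral>x. norm (h n x) \<partial>M))"
    using h by (intro suminf_cong nn_integral_eq_integral) auto
  also have "\<dots> \<noteq> \<infinity>"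
    using int by (simp add: ennreal_suminf_neq_top)
  finally have "AE x in M. (\<Sum>n. ennreal (norm (h n x))) \<noteq> \<infinity>"
    by (intro nn_integral_PInf_AE) (auto simp: less_top)
  then have AE: "AE x in M. summable (\<lambda>n. norm (h n x))"
    by eventually_elim (auto intro: summable_suminf_not_top)
  define g where "g x = (\<Sum>n. h n x)" for x
  have g: "integrable M g" and G: "integrable M (\<lambda>x. \<Sum>n. norm (h n x))"
    unfolding g_def using AE h int by (auto intro!: integrable_suminf)
  have partial: "f n x - f 0 x = (\<Sum>j<n. h j x)" for n x
    unfolding h_def by (rule sum_lessThan_telescope[symmetric])
  \<comment> \<open>The remainder is a tail of the increment series, dominated by the full sum of
    absolute increments.\<close>
  have "(\<lambda>n. \<integral>x. \<bar>f n x - (f 0 x + g x)\<bar> \<partial>M) \<longlonglongrightarrow> (\<integral>x. 0 \<partial>M)"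
  proof (rule integral_dominated_convergence[OF _ _ G])
    show "AE x in M. (\<lambda>n. \<bar>f n x - (f 0 x + g x)\<bar>) \<longlonglongrightarrow> 0"
      using AE
    proof eventually_elim
      case (elim x)
      have "(\<lambda>n. \<Sum>j<n. h j x) \<longlonglongrightarrow> g x"
        unfolding g_def using summable_norm_cancel[OF elim] by (rule summable_LIMSEQ)
      then have "(\<lambda>n. \<bar>(\<Sum>j<n. h j x) - g x\<bar>) \<longlonglongrightarrow> \<bar>g x - g x\<bar>"
        by (intro tendsto_intros)
      then show ?case by (simp add: partial[symmetric] algebra_simps)
    qed
    show "AE x in M. norm \<bar>f n x - (f 0 x + g x)\<bar> \<le> (\<Sum>j. norm (h j x))" for n
      using AE
    proof eventually_elim
      case (elim x)
      have "f n x - (f 0 x + g x) = - (\<Sum>j. h (j + n) x)"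
        using suminf_split_initial_segment[OF summable_norm_cancel[OF elim], of n]
        by (simp add: g_def partial[symmetric])
      also have "norm \<dots> \<le> (\<Sum>j. norm (h (j + n) x))"
        using summable_norm[OF summable_ignore_initial_segment[OF elim, of n]] by simp
      also have "\<dots> \<le> (\<Sum>j. norm (h j x))"
        using suminf_split_initial_segment[OF elim, of n] by (simp add: sum_nonneg)
      finally show ?case by simp
    qed
  qed (use f g in auto)
  then have "(\<lambda>n. vnorm (L1 M) (X n \<ominus>\<^bsub>L1 M\<^esub> L1_class M (\<lambda>x. f 0 x + g x))) \<longlonglongrightarrow> 0"
    using f g by (simp add: minus_L1 vnorm_L1)
  then show "\<exists>l\<in>carrier (L1 M). (\<lambda>n. vnorm (L1 M) (X n \<ominus>\<^bsub>L1 M\<^esub> l)) \<longlonglongrightarrow> 0"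
    using f g by (intro bexI) (auto simp: carrier_L1)
qed


section \<open>Finitely supported functions of sum zero\<close>

text \<open>For a group this is the augmentation ideal of its real group ring. A finite set merely
  containing the support is easier to exhibit; \<open>zero_sum_iff\<close> passes to the exact
  support.\<close>

definition zero_sum :: "'a set \<Rightarrow> ('a \<Rightarrow> real) set" where
  "zero_sum X = {f. \<exists>A. finite A \<and> A \<subseteq> X \<and> (\<forall>x. x \<notin> A \<longrightarrow> f x = 0) \<and> sum f A = 0}"

definition supp :: "('a \<Rightarrow> real) \<Rightarrow> 'a set" where
  "supp f = {x. f x \<noteq> 0}"

lemma zero_sum_iff: "f \<in> zero_sum X \<longleftrightarrow> finite (supp f) \<and> supp f \<subseteq> X \<and> sum f (supp f) = 0"
proof
  assume "f \<in> zero_sum X"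
  then obtain A where A: "finite A" "A \<subseteq> X" "\<And>x. x \<notin> A \<Longrightarrow> f x = 0" "sum f A = 0"
    by (auto simp: zero_sum_def)
  then have "supp f \<subseteq> A" by (auto simp: supp_def)
  moreover from this have "sum f (supp f) = sum f A"
    using A by (intro sum.mono_neutral_left) (auto simp: supp_def)
  ultimately show "finite (supp f) \<and> supp f \<subseteq> X \<and> sum f (supp f) = 0"
    using A finite_subset by auto
qed (auto simp: zero_sum_def supp_def intro!: exI[of _ "supp f"])

lemma sum_supp:
  fixes g :: "'a \<Rightarrow> real \<Rightarrow> real"
  assumes "finite A" "supp f \<subseteq> A" "\<And>x. g x 0 = 0"
  shows "(\<Sum>x\<in>supp f. g x (f x)) = (\<Sum>x\<in>A. g x (f x))"
  using assms by (intro sum.mono_neutral_left) (auto simp: supp_def)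

text \<open>The value 0 outside the carrier keeps supports inside the group, which may be a proper
  part of its type.\<close>

definition translate :: "('a, 'b) monoid_scheme \<Rightarrow> 'a \<Rightarrow> ('a \<Rightarrow> real) \<Rightarrow> 'a \<Rightarrow> real" where
  "translate G s f x = (if x \<in> carrier G then f (inv\<^bsub>G\<^esub> s \<otimes>\<^bsub>G\<^esub> x) else 0)"

context group
begin

lemma supp_translate:
  assumes "s \<in> carrier G" "supp f \<subseteq> carrier G"
  shows "supp (translate G s f) = (\<lambda>x. s \<otimes> x) ` supp f"
proof
  show "supp (translate G s f) \<subseteq> (\<lambda>x. s \<otimes> x) ` supp f"
  proof
    fix x assume "x \<in> supp (translate G s f)"
    then have "x \<in> carrier G" "inv s \<otimes> x \<in> supp f"
      by (auto simp: supp_def translate_def split: if_splits)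
    moreover from this have "x = s \<otimes> (inv s \<otimes> x)" using assms(1) by (simp add: m_assoc[symmetric])
    ultimately show "x \<in> (\<lambda>x. s \<otimes> x) ` supp f" by blast
  qed
  show "(\<lambda>x. s \<otimes> x) ` supp f \<subseteq> supp (translate G s f)"
    using assms by (auto simp: supp_def translate_def m_assoc[symmetric])
qed

lemma translate_mult:
  assumes "s \<in> carrier G" "x \<in> carrier G"
  shows "translate G s f (s \<otimes> x) = f x"
  using assms by (simp add: translate_def m_assoc[symmetric])

text \<open>Left multiplication reindexes the support. The general \<open>g\<close> covers the total
  sum, the \<open>l1\<close> norm and each variable of a quadratic form.\<close>

lemma sum_supp_translate:
  assumes "s \<in> carrier G" "supp f \<subseteq> carrier G"
  shows "(\<Sum>x\<in>supp (translate G s f). g x (translate G s f x)) = (\<Sum>x\<in>supp f. g (s \<otimes> x) (f x))"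
proof -
  have "inj_on (\<lambda>x. s \<otimes> x) (supp f)" using assms by (auto simp: inj_on_def subset_iff)
  then show ?thesis
    using assms by (simp add: supp_translate sum.reindex) (auto intro!: sum.cong simp: translate_mult)
qed

lemma translate_zero_sum:
  assumes "s \<in> carrier G" "f \<in> zero_sum (carrier G)"
  shows "translate G s f \<in> zero_sum (carrier G)"
  using assms sum_supp_translate[of s f "\<lambda>_ r. r"] unfolding zero_sum_iff
  by (auto simp: supp_translate)

lemma translate_translate:
  assumes "s \<in> carrier G" "t \<in> carrier G"
  shows "translate G (s \<otimes> t) f = translate G s (translate G t f)"
  using assms by (auto simp: translate_def inv_mult_group m_assoc fun_eq_iff)

lemma translate_one:
  assumes "supp f \<subseteq> carrier G"
  shows "translate G \<one> f = f"
  using assms by (auto simp: translate_def supp_def fun_eq_iff)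

end

lemma zero_sum_add: "f \<in> zero_sum X \<Longrightarrow> g \<in> zero_sum X \<Longrightarrow> (\<lambda>x. f x + g x) \<in> zero_sum X"
proof -
  assume f: "f \<in> zero_sum X" and g: "g \<in> zero_sum X"
  let ?A = "supp f \<union> supp g"
  have "finite ?A" "?A \<subseteq> X" using f g by (auto simp: zero_sum_iff)
  moreover have "(\<Sum>x\<in>?A. f x + g x) = 0"
    using f g sum_supp[of ?A f "\<lambda>_ r. r"] sum_supp[of ?A g "\<lambda>_ r. r"]
    by (simp add: sum.distrib zero_sum_iff)
  ultimately show ?thesis
    unfolding zero_sum_def by (intro CollectI exI[of _ ?A]) (auto simp: supp_def)
qed

lemma zero_sum_smult: "f \<in> zero_sum X \<Longrightarrow> (\<lambda>x. c * f x) \<in> zero_sum X"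
  unfolding zero_sum_def by (auto simp: sum_distrib_left[symmetric])

text \<open>This gathers what the kernel and the Gaussian construction deliver, separating the
  action from their details.\<close>

locale l1_model = group G for G :: "('a, 'b) monoid_scheme" (structure) +
  fixes k :: "'a \<Rightarrow> 'a \<Rightarrow> real" and \<mu> :: "'w measure" and V :: "'a \<Rightarrow> 'w \<Rightarrow> real" and c :: real
  assumes psd: "psd_on (carrier G) k"
    and almost_invariant: "\<lbrakk>finite A; A \<subseteq> carrier G; sum f A = 0; s \<in> carrier G\<rbrakk> \<Longrightarrow>
      (\<Sum>x\<in>A. \<Sum>y\<in>A. f x * f y * k (s \<otimes> x) (s \<otimes> y))
        \<le> (\<Sum>x\<in>A. \<Sum>y\<in>A. f x * f y * k x y) + (\<Sum>x\<in>A. \<bar>f x\<bar>)\<^sup>2"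
    and k_one: "x \<in> carrier G \<Longrightarrow> k x \<one> = 0"
    and proper: "finite {x \<in> carrier G. k x x \<le> R}"
    and c_pos: "c > 0"
    and V_integrable: "x \<in> carrier G \<Longrightarrow> integrable \<mu> (V x)"
    and V_norm: "\<lbrakk>finite A; A \<subseteq> carrier G\<rbrakk> \<Longrightarrow> (\<integral>\<omega>. \<bar>\<Sum>x\<in>A. f x * V x \<omega>\<bar> \<partial>\<mu>) =
      c * sqrt (\<Sum>x\<in>A. \<Sum>y\<in>A. f x * f y * k x y) + (\<Sum>x\<in>A. \<bar>f x\<bar>)"
begin

definition embed :: "('a \<Rightarrow> real) \<Rightarrow> ('w \<Rightarrow> real) set" where
  "embed f = L1_class \<mu> (\<lambda>\<omega>. \<Sum>x\<in>supp f. f x * V x \<omega>)"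

lemma embed_eq:
  assumes "finite A" "supp f \<subseteq> A"
  shows "embed f = L1_class \<mu> (\<lambda>\<omega>. \<Sum>x\<in>A. f x * V x \<omega>)"
  unfolding embed_def using sum_supp[OF assms, of "\<lambda>x r. r * V x _"] by simp

lemma combination_integrable: "A \<subseteq> carrier G \<Longrightarrow> integrable \<mu> (\<lambda>\<omega>. \<Sum>x\<in>A. f x * V x \<omega>)"
  using V_integrable by (intro Bochner_Integration.integrable_sum integrable_mult_right) auto

lemma embed_carrier: "f \<in> zero_sum (carrier G) \<Longrightarrow> embed f \<in> carrier (L1 \<mu>)"
  unfolding embed_def carrier_L1 using combination_integrable by (auto simp: zero_sum_iff)

lemma embed_add:
  assumes f: "f \<in> zero_sum (carrier G)" and g: "g \<in> zero_sum (carrier G)"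
  shows "embed (\<lambda>x. f x + g x) = embed f \<oplus>\<^bsub>L1 \<mu>\<^esub> embed g"
proof -
  let ?A = "supp f \<union> supp g"
  have A: "finite ?A" "?A \<subseteq> carrier G" using f g by (auto simp: zero_sum_iff)
  have "embed (\<lambda>x. f x + g x) = L1_class \<mu> (\<lambda>\<omega>. \<Sum>x\<in>?A. (f x + g x) * V x \<omega>)"
    using A by (intro embed_eq) (auto simp: supp_def)
  moreover have "embed f = L1_class \<mu> (\<lambda>\<omega>. \<Sum>x\<in>?A. f x * V x \<omega>)"
    "embed g = L1_class \<mu> (\<lambda>\<omega>. \<Sum>x\<in>?A. g x * V x \<omega>)"
    using A by (auto intro!: embed_eq)
  ultimately show ?thesis
    using combination_integrable[OF A(2)] by (simp add: add_L1 distrib_right sum.distrib)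
qed

lemma embed_smult:
  assumes f: "f \<in> zero_sum (carrier G)"
  shows "embed (\<lambda>x. r * f x) = r \<odot>\<^bsub>L1 \<mu>\<^esub> embed f"
proof -
  have A: "finite (supp f)" "supp f \<subseteq> carrier G" using f by (auto simp: zero_sum_iff)
  have "embed (\<lambda>x. r * f x) = L1_class \<mu> (\<lambda>\<omega>. \<Sum>x\<in>supp f. (r * f x) * V x \<omega>)"
    using A by (intro embed_eq) (auto simp: supp_def)
  then show ?thesis
    using combination_integrable[OF A(2)] by (simp add: embed_def smult_L1 sum_distrib_left mult.assoc)
qed

lemma vnorm_embed:
  assumes f: "f \<in> zero_sum (carrier G)"
  shows "vnorm (L1 \<mu>) (embed f) =
    c * sqrt (\<Sum>x\<in>supp f. \<Sum>y\<in>supp f. f x * f y * k x y) + (\<Sum>x\<in>supp f. \<bar>f x\<bar>)"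
  using f combination_integrable[of "supp f" f] V_norm[of "supp f" f]
  by (simp add: embed_def vnorm_L1 zero_sum_iff)

text \<open>The \<open>l1\<close> term of the norm separates functions. Hence translation is well
  defined on the image.\<close>

lemma inj_on_embed: "inj_on embed (zero_sum (carrier G))"
proof (rule inj_onI)
  interpret L: banach_module "L1 \<mu>" by (rule banach_module_L1)
  fix f g assume fg: "f \<in> zero_sum (carrier G)" "g \<in> zero_sum (carrier G)" "embed f = embed g"
  define h where "h x = f x + (- 1) * g x" for x
  have g': "(\<lambda>x. (- 1) * g x) \<in> zero_sum (carrier G)" by (rule zero_sum_smult[OF fg(2)])
  have h: "h \<in> zero_sum (carrier G)"
    unfolding h_def by (rule zero_sum_add[OF fg(1) g'])
  have "embed h = embed f \<oplus>\<^bsub>L1 \<mu>\<^esub> ((- 1) \<odot>\<^bsub>L1 \<mu>\<^esub> embed g)"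
    unfolding h_def using embed_add[OF fg(1) g'] embed_smult[OF fg(2), of "- 1"] by simp
  also have "\<dots> = \<zero>\<^bsub>L1 \<mu>\<^esub>"
    using fg embed_carrier by (simp add: L.uminus_eq_smult[symmetric] L.M.r_neg)
  finally have "vnorm (L1 \<mu>) (embed h) = 0" by simp
  moreover have "c * sqrt (\<Sum>x\<in>supp h. \<Sum>y\<in>supp h. h x * h y * k x y) \<ge> 0"
    using h c_pos psd_on_nonneg[OF psd] by (auto simp: zero_sum_iff)
  moreover have "(\<Sum>x\<in>supp h. \<bar>h x\<bar>) \<ge> 0" by (simp add: sum_nonneg)
  ultimately have "(\<Sum>x\<in>supp h. \<bar>h x\<bar>) = 0" using vnorm_embed[OF h] by linarith
  then have "\<And>x. x \<in> supp h \<Longrightarrow> h x = 0"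
    using h by (auto simp: zero_sum_iff sum_nonneg_eq_0_iff)
  then have "h x = 0" for x by (cases "x \<in> supp h") (auto simp: supp_def)
  then show "f = g" by (auto simp: h_def fun_eq_iff)
qed

text \<open>The \<open>l1\<close> term is exactly invariant and absorbs the defect of the quadratic
  form, because \<open>sqrt (Q + n\<^sup>2) \<le> sqrt Q + n\<close>.\<close>

lemma vnorm_embed_translate_le:
  assumes f: "f \<in> zero_sum (carrier G)" and s: "s \<in> carrier G"
  shows "vnorm (L1 \<mu>) (embed (translate G s f)) \<le> (1 + c) * vnorm (L1 \<mu>) (embed f)"
proof -
  have S: "finite (supp f)" "supp f \<subseteq> carrier G" "sum f (supp f) = 0" using f by (auto simp: zero_sum_iff)
  define Q where "Q = (\<Sum>x\<in>supp f. \<Sum>y\<in>supp f. f x * f y * k x y)"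
  define n where "n = (\<Sum>x\<in>supp f. \<bar>f x\<bar>)"
  have Q: "Q \<ge> 0" unfolding Q_def by (rule psd_on_nonneg[OF psd S(1,2)])
  have n: "n \<ge> 0" unfolding n_def by (simp add: sum_nonneg)
  let ?g = "translate G s f"
  have "(\<Sum>x\<in>supp ?g. \<Sum>y\<in>supp ?g. ?g x * ?g y * k x y)
      = (\<Sum>x\<in>supp f. \<Sum>y\<in>supp f. f x * f y * k (s \<otimes> x) (s \<otimes> y))"
  proof -
    have "(\<Sum>y\<in>supp ?g. ?g x * ?g y * k x y) = (\<Sum>y\<in>supp f. ?g x * f y * k x (s \<otimes> y))" for x
      using sum_supp_translate[OF s S(2), of "\<lambda>y r. ?g x * r * k x y"] .
    then show ?thesis
      using sum_supp_translate[OF s S(2), of "\<lambda>x r. \<Sum>y\<in>supp f. r * f y * k x (s \<otimes> y)"] by simp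
  qed
  also have "\<dots> \<le> Q + n\<^sup>2"
    unfolding Q_def n_def using S s by (intro almost_invariant) auto
  finally have "sqrt (\<Sum>x\<in>supp ?g. \<Sum>y\<in>supp ?g. ?g x * ?g y * k x y) \<le> sqrt (Q + n\<^sup>2)" by simp
  also have "\<dots> \<le> sqrt Q + n"
    using sqrt_add_le_add_sqrt[of Q "n\<^sup>2"] Q n by simp
  finally have "c * sqrt (\<Sum>x\<in>supp ?g. \<Sum>y\<in>supp ?g. ?g x * ?g y * k x y) \<le> c * (sqrt Q + n)"
    using c_pos by (intro mult_left_mono) auto
  moreover have "(\<Sum>x\<in>supp ?g. \<bar>?g x\<bar>) = n"
    unfolding n_def using sum_supp_translate[OF s S(2), of "\<lambda>_ r. \<bar>r\<bar>"] .
  ultimately have "vnorm (L1 \<mu>) (embed ?g) \<le> c * (sqrt Q + n) + n"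
    using vnorm_embed[OF translate_zero_sum[OF s f]] by simp
  also have "\<dots> \<le> (1 + c) * (c * sqrt Q + n)"
    using Q n c_pos by (simp add: algebra_simps)
  also have "c * sqrt Q + n = vnorm (L1 \<mu>) (embed f)"
    using vnorm_embed[OF f] by (simp add: Q_def n_def)
  finally show ?thesis .
qed

text \<open>Formally the translate by \<open>s\<close> of the point mass at \<one>, minus that point
  mass, which itself lies outside the space of functions of sum zero.\<close>

definition coboundary :: "'a \<Rightarrow> 'a \<Rightarrow> real" where
  "coboundary s x = of_bool (x = s) - of_bool (x = \<one>)"

lemma supp_coboundary: "supp (coboundary s) \<subseteq> {s, \<one>}"
  by (auto simp: supp_def coboundary_def)

lemma coboundary_zero_sum: "s \<in> carrier G \<Longrightarrow> coboundary s \<in> zero_sum (carrier G)"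
  unfolding zero_sum_def
  by (intro CollectI exI[of _ "{s, \<one>}"]) (cases "s = \<one>", auto simp: coboundary_def)

lemma coboundary_mult:
  assumes "s \<in> carrier G" "t \<in> carrier G"
  shows "coboundary (s \<otimes> t) = (\<lambda>x. translate G s (coboundary t) x + coboundary s x)"
proof
  fix x
  have "inv s \<otimes> x = t \<longleftrightarrow> x = s \<otimes> t" "inv s \<otimes> x = \<one> \<longleftrightarrow> x = s" if "x \<in> carrier G"
    using assms that inv_solve_left'[of t s x] inv_solve_left'[of \<one> s x] by auto
  then show "coboundary (s \<otimes> t) x = translate G s (coboundary t) x + coboundary s x"
    using assms by (auto simp: coboundary_def translate_def)
qed

text \<open>Entries of \<open>k\<close> involving \<one> vanish, so the quadratic form reduces to
  \<open>k s s\<close>; the \<open>l1\<close> term only increases the norm.\<close>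

lemma vnorm_embed_coboundary:
  assumes s: "s \<in> carrier G"
  shows "c * sqrt (k s s) \<le> vnorm (L1 \<mu>) (embed (coboundary s))"
proof -
  let ?f = "coboundary s"
  have z: "k \<one> s = 0" "k s \<one> = 0" "k \<one> \<one> = 0"
    using k_one s psd_on_sym[OF psd, of \<one> s] by auto
  have "(\<Sum>x\<in>supp ?f. \<Sum>y\<in>supp ?f. ?f x * ?f y * k x y) = (\<Sum>x\<in>supp ?f. \<Sum>y\<in>{s, \<one>}. ?f x * ?f y * k x y)"
    using sum_supp[OF _ supp_coboundary, of s "\<lambda>y r. ?f _ * r * k _ y"] by simp
  also have "\<dots> = (\<Sum>x\<in>{s, \<one>}. \<Sum>y\<in>{s, \<one>}. ?f x * ?f y * k x y)"
    using sum_supp[OF _ supp_coboundary, of s "\<lambda>x r. \<Sum>y\<in>{s, \<one>}. r * ?f y * k x y"] by simp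
  also have "\<dots> = k s s"
    using z by (cases "s = \<one>") (auto simp: coboundary_def)
  finally show ?thesis
    using vnorm_embed[OF coboundary_zero_sum[OF s]] by (simp add: sum_nonneg)
qed

theorem proper_affine_action:
  "\<exists>E \<pi> b. closed_subspace E (L1 \<mu>) \<and> affine_action G ((L1 \<mu>)\<lparr>carrier := E\<rparr>) \<pi> b \<and>
    uniformly_lipschitz G ((L1 \<mu>)\<lparr>carrier := E\<rparr>) (affine_map ((L1 \<mu>)\<lparr>carrier := E\<rparr>) \<pi> b) \<and>
    proper_action G ((L1 \<mu>)\<lparr>carrier := E\<rparr>) (affine_map ((L1 \<mu>)\<lparr>carrier := E\<rparr>) \<pi> b)"
proof -
  interpret L: banach_module "L1 \<mu>" by (rule banach_module_L1)
  let ?Z = "zero_sum (carrier G)"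
  define D where "D = embed ` ?Z"
  \<comment> \<open>Translation is carried to the image along \<open>embed\<close>, which is
    injective on functions of sum zero.\<close>
  define T where "T s v = embed (translate G s (inv_into ?Z embed v))" for s v
  define b where "b s = embed (coboundary s)" for s
  have T: "T s (embed f) = embed (translate G s f)" if "f \<in> ?Z" for s f
    using that inj_on_embed by (simp add: T_def)
  have zero: "(\<lambda>_. 0) \<in> ?Z" by (auto simp: zero_sum_def)
  have "\<exists>E \<pi>. closed_subspace E (L1 \<mu>) \<and> affine_action G ((L1 \<mu>)\<lparr>carrier := E\<rparr>) \<pi> b \<and>
    uniformly_lipschitz G ((L1 \<mu>)\<lparr>carrier := E\<rparr>) (affine_map ((L1 \<mu>)\<lparr>carrier := E\<rparr>) \<pi> b) \<and>
    proper_action G ((L1 \<mu>)\<lparr>carrier := E\<rparr>) (affine_map ((L1 \<mu>)\<lparr>carrier := E\<rparr>) \<pi> b)"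
  proof (rule L.extend_affine_action[where D = D and T = T and C = "1 + c"])
    show "submodule D scalars (L1 \<mu>)"
    proof (rule L.submoduleI)
      show "D \<subseteq> carrier (L1 \<mu>)" using embed_carrier by (auto simp: D_def)
      show smult: "r \<odot>\<^bsub>L1 \<mu>\<^esub> x \<in> D" if "x \<in> D" for r x
        using that by (auto simp: D_def embed_smult[symmetric] intro!: imageI zero_sum_smult)
      show "x \<oplus>\<^bsub>L1 \<mu>\<^esub> y \<in> D" if "x \<in> D" "y \<in> D" for x y
        using that by (auto simp: D_def embed_add[symmetric] intro!: imageI zero_sum_add)
      show "\<ominus>\<^bsub>L1 \<mu>\<^esub> x \<in> D" if "x \<in> D" for x
        using smult[OF that] that embed_carrier by (auto simp: D_def L.uminus_eq_smult)
      have "embed (\<lambda>_. 0) = \<zero>\<^bsub>L1 \<mu>\<^esub>" by (simp add: embed_def supp_def zero_L1)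
      then show "\<zero>\<^bsub>L1 \<mu>\<^esub> \<in> D" using zero by (force simp: D_def)
    qed
    show "L.bounded_endo D (1 + c) (T s)" if s: "s \<in> carrier G" for s
      unfolding L.bounded_endo_def
    proof (intro conjI ballI allI)
      show "T s \<in> D \<rightarrow> D" using s by (auto simp: D_def T translate_zero_sum)
      show "T s (x \<oplus>\<^bsub>L1 \<mu>\<^esub> y) = T s x \<oplus>\<^bsub>L1 \<mu>\<^esub> T s y" if xy: "x \<in> D" "y \<in> D" for x y
      proof -
        obtain f where f: "x = embed f" "f \<in> ?Z" using xy(1) by (auto simp: D_def)
        obtain g where g: "y = embed g" "g \<in> ?Z" using xy(2) by (auto simp: D_def)
        have "translate G s (\<lambda>x. f x + g x) = (\<lambda>x. translate G s f x + translate G s g x)"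
          by (auto simp: translate_def fun_eq_iff)
        then show ?thesis
          using f g s by (simp add: embed_add[symmetric] T zero_sum_add translate_zero_sum)
      qed
      show "T s (r \<odot>\<^bsub>L1 \<mu>\<^esub> x) = r \<odot>\<^bsub>L1 \<mu>\<^esub> T s x" if x: "x \<in> D" for r x
      proof -
        obtain f where f: "x = embed f" "f \<in> ?Z" using x by (auto simp: D_def)
        have "translate G s (\<lambda>x. r * f x) = (\<lambda>x. r * translate G s f x)"
          by (auto simp: translate_def fun_eq_iff)
        then show ?thesis
          using f s by (simp add: embed_smult[symmetric] T zero_sum_smult translate_zero_sum)
      qed
      show "vnorm (L1 \<mu>) (T s x) \<le> (1 + c) * vnorm (L1 \<mu>) x" if "x \<in> D" for x
        using that s vnorm_embed_translate_le by (auto simp: D_def T)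
    qed (use c_pos in auto)
    show "T (s \<otimes> t) d = T s (T t d)" if "s \<in> carrier G" "t \<in> carrier G" "d \<in> D" for s t d
      using that by (auto simp: D_def T translate_zero_sum translate_translate)
    show "T \<one> d = d" if "d \<in> D" for d
      using that by (auto simp: D_def T translate_one zero_sum_iff)
    show "b \<in> carrier G \<rightarrow> D" using coboundary_zero_sum by (auto simp: b_def D_def)
    show "b (s \<otimes> t) = T s (b t) \<oplus>\<^bsub>L1 \<mu>\<^esub> b s" if "s \<in> carrier G" "t \<in> carrier G" for s t
      using that coboundary_zero_sum
      by (simp add: b_def coboundary_mult embed_add T translate_zero_sum)
    show "finite {s \<in> carrier G. vnorm (L1 \<mu>) (b s) \<le> R}" for R
    proof (rule finite_subset[OF _ proper])
      \<comment> \<open>Properness of the cocycle is inherited from the diagonal growth of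
        \<open>k\<close>.\<close>
      show "{s \<in> carrier G. vnorm (L1 \<mu>) (b s) \<le> R} \<subseteq> {s \<in> carrier G. k s s \<le> (R / c)\<^sup>2}"
      proof clarify
        fix s assume s: "s \<in> carrier G" and "vnorm (L1 \<mu>) (b s) \<le> R"
        then have "c * sqrt (k s s) \<le> R" using vnorm_embed_coboundary[OF s] by (simp add: b_def)
        then have "sqrt (k s s) \<le> R / c" using c_pos by (simp add: field_simps)
        then show "k s s \<le> (R / c)\<^sup>2" by (rule sqrt_le_D)
      qed
    qed
  qed (use c_pos is_group in auto)
  then show ?thesis by blast
qed

end

theorem theorem1p4:
  fixes G :: "('a, 'b) monoid_scheme"
  assumes "group G" and "countable (carrier G)"
    and "weakly_amenable G" and "cowling_haagerup G = 1"
  shows "\<exists>(\<mu> :: (nat \<Rightarrow> real) measure) E \<pi> b.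
    closed_subspace E (L1 \<mu>) \<and>
    affine_action G ((L1 \<mu>)\<lparr>carrier := E\<rparr>) \<pi> b \<and>
    uniformly_lipschitz G ((L1 \<mu>)\<lparr>carrier := E\<rparr>) (affine_map ((L1 \<mu>)\<lparr>carrier := E\<rparr>) \<pi> b) \<and>
    proper_action G ((L1 \<mu>)\<lparr>carrier := E\<rparr>) (affine_map ((L1 \<mu>)\<lparr>carrier := E\<rparr>) \<pi> b)"
proof -
  obtain k where k: "psd_on (carrier G) k"
    "\<And>A f s. finite A \<Longrightarrow> A \<subseteq> carrier G \<Longrightarrow> sum f A = 0 \<Longrightarrow> s \<in> carrier G \<Longrightarrow>
      (\<Sum>x\<in>A. \<Sum>y\<in>A. f x * f y * k (s \<otimes>\<^bsub>G\<^esub> x) (s \<otimes>\<^bsub>G\<^esub> y))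
        \<le> (\<Sum>x\<in>A. \<Sum>y\<in>A. f x * f y * k x y) + (\<Sum>x\<in>A. \<bar>f x\<bar>)\<^sup>2"
    "\<And>x. x \<in> carrier G \<Longrightarrow> k x \<one>\<^bsub>G\<^esub> = 0" "\<And>R. finite {x \<in> carrier G. k x x \<le> R}"
    by (rule almost_invariant_proper_kernel[OF assms]) (rule that)
  have "carrier G \<noteq> {}" using group.is_monoid[OF assms(1)] monoid.one_closed by blast
  then obtain \<mu> :: "(nat \<Rightarrow> real) measure" and V where V:
    "\<And>x. x \<in> carrier G \<Longrightarrow> integrable \<mu> (V x)"
    "\<And>A f. finite A \<Longrightarrow> A \<subseteq> carrier G \<Longrightarrow> (\<integral>\<omega>. \<bar>\<Sum>x\<in>A. f x * V x \<omega>\<bar> \<partial>\<mu>) =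
      sqrt (2 / pi) * sqrt (\<Sum>x\<in>A. \<Sum>y\<in>A. f x * f y * k x y) + (\<Sum>x\<in>A. \<bar>f x\<bar>)"
    by (rule l1_model_of_psd_kernel[OF k(1) assms(2)]) (rule that)
  \<comment> \<open>The constant is the first absolute moment of a standard Gaussian.\<close>
  have "l1_model G k \<mu> V (sqrt (2 / pi))"
    by (intro l1_model.intro l1_model_axioms.intro assms(1) k V) auto
  then show ?thesis using l1_model.proper_affine_action by blast
qed

end
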